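(* For every $M\in\mathbb N$ and every prime power $q$, for almost all $a\in(\mathbb F_q^M)^\infty$ (with respect to the uniform product (Haar) measure), $$\limsup_{n\to\infty}\frac{d_a(n)}{\log n}=\frac{1}{(M+1)\log q}\qquad\text{and}\qquad\liminf_{n\to\infty}\frac{d_a(n)}{\log n}=-\frac{1}{(M+1)\log q}.$$
   Context: Let $q$ be a prime power and $M\ge1$. For a multisequence $a=(a_{k,m})_{k\ge1,\,1\le m\le M}\in(\mathbb F_q^M)^\infty$ and $n\in\mathbb N_0$, the linear complexity $L_a(n)$ is the least $L\ge0$ such that there exist $c_1,\dots,c_L\in\mathbb F_q$ with $a_{k,m}=\sum_{i=1}^L c_i a_{k-i,m}$ for all $L<k\le n$ and all $1\le m\le M$ (a single linear feedback shift register of length $L$ generating the first $n$ terms of all $M$ sequences); $L_a(0)=0$. The linear complexity deviation is $d_a(n)=L_a(n)-\lceil nM/(M+1)\rceil$. *)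

theory Defs
  imports "HOL-Probability.Probability"
begin

text \<open>A multisequence over the field 'a with M components is a function a with a (k,m)
  the k-th term (k \<ge> 1) of the m-th sequence (1 \<le> m \<le> M).\<close>

definition lfsr_generates :: "nat \<Rightarrow> (nat \<times> nat \<Rightarrow> 'a::field) \<Rightarrow> nat \<Rightarrow> nat \<Rightarrow> bool" where
  "lfsr_generates M a n L \<longleftrightarrow>
     (\<exists>c :: nat \<Rightarrow> 'a. \<forall>k m. L < k \<and> k \<le> n \<and> 1 \<le> m \<and> m \<le> M \<longrightarrow>
        a (k, m) = (\<Sum>i = 1..L. c i * a (k - i, m)))"

definition linear_complexity :: "nat \<Rightarrow> (nat \<times> nat \<Rightarrow> 'a::field) \<Rightarrow> nat \<Rightarrow> nat" where
  "linear_complexity M a n = (LEAST L. lfsr_generates M a n L)"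

definition lc_deviation :: "nat \<Rightarrow> (nat \<times> nat \<Rightarrow> 'a::field) \<Rightarrow> nat \<Rightarrow> int" where
  "lc_deviation M a n = int (linear_complexity M a n) - \<lceil>real (n * M) / real (M + 1)\<rceil>"

definition multiseq_measure :: "nat \<Rightarrow> (nat \<times> nat \<Rightarrow> 'a::finite) measure" where
  "multiseq_measure M = (\<Pi>\<^sub>M i \<in> {1..} \<times> {1..M}. measure_pmf (pmf_of_set (UNIV :: 'a set)))"

end

(*
  Let q be the field size, L n the linear complexity and X n = (M + 1) * L n - n * M, which differs
  from (M + 1) times the deviation by a bounded amount.

  Tails. If L n <= L, some nonzero vector of L + 1 coefficients annihilates (n - L) * M windows of the
  sequence; if L n > L, linear duality gives a nonzero vector of (n - L) * M coefficients annihilating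
  L windows. For fixed coefficients each condition determines one fresh symbol, so union bounds
  give P(X n < -T) <= q^(1 - T) and P(X n > T) <= q^(M + 1 - T), and the first Borel-Cantelli lemma
  bounds the limsup and the liminf.

  Attainment. Cut time into consecutive blocks of length about log_q(j) / M, resp. log_q(j). In the
  first case ask that the current register predict the whole block, in the second that a linear
  relation between r ~ n / (M + 1) consecutive vectors persist through the block and fail at its last
  step. Whatever the past, these events have the same probability of order 1 / j, hence they are
  independent and infinitely many of them occur. The past fails to be typical (X n large, resp. no
  such relation available) only with probability j^(-delta), and being independent of the block event
  this costs only a summable amount.
*)

theory Submission
  imports Defs "HOL-Real_Asymp.Real_Asymp"
begin

section \<open>Events depending on finitely many symbols\<close>

text \<open>The complexities at different times are strongly dependent, so the second Borel-Cantelli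
  lemma cannot be aimed at them directly. Instead a forecasting rule is frozen at the start of each
  block. It is chosen as a function of the prefix, also on prefixes where it is worthless, and every
  symbol of the block is compared with its forecast. One value out of q is a hit, whence the
  probability of a pattern of hits and misses is exactly the same for all prefixes.

  The tails and the two constructions meet at the same constant because each of them trades one
  factor q for one unit of X. A step survived by the register costs q^(-M) and lowers X by M; a step
  survived by a single relation costs q^(-1) and improves the final lower bound on X by 1. This is
  why the block lengths differ by the factor M while the gain is about log_q(j) in both cases. Block
  j ends at a time of order at most j log j, so log_q(j) and log_q(n) agree to first order.

  All the linear algebra is about one object, the block Hankel matrix with rows (k, m), columns i
  and entries \<open>a (k + i, m)\<close>.\<close>

definition depends_on :: "'i set \<Rightarrow> (('i \<Rightarrow> 'b) \<Rightarrow> bool) \<Rightarrow> bool" where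
  "depends_on J P \<longleftrightarrow> (\<forall>a b. (\<forall>i\<in>J. a i = b i) \<longrightarrow> P a = P b)"

lemma depends_onI:
  assumes "\<And>a b. (\<And>i. i \<in> J \<Longrightarrow> a i = b i) \<Longrightarrow> P a \<Longrightarrow> P b"
  shows "depends_on J P"
  unfolding depends_on_def using assms by (metis (no_types, lifting))

lemma depends_onD:
  assumes "depends_on J P" "\<And>i. i \<in> J \<Longrightarrow> a i = b i"
  shows "P a = P b"
  using assms unfolding depends_on_def by blast

lemma depends_on_mono: "depends_on J P \<Longrightarrow> J \<subseteq> K \<Longrightarrow> depends_on K P"
  unfolding depends_on_def by blast

lemma depends_on_conj: "depends_on J P \<Longrightarrow> depends_on J Q \<Longrightarrow> depends_on J (\<lambda>a. P a \<and> Q a)"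
  unfolding depends_on_def by blast

lemma depends_on_not: "depends_on J P \<Longrightarrow> depends_on J (\<lambda>a. \<not> P a)"
  unfolding depends_on_def by blast

lemma depends_on_all: "(\<And>x. x \<in> X \<Longrightarrow> depends_on J (P x)) \<Longrightarrow> depends_on J (\<lambda>a. \<forall>x\<in>X. P x a)"
  unfolding depends_on_def by blast

lemma depends_on_ex: "(\<And>x. depends_on J (P x)) \<Longrightarrow> depends_on J (\<lambda>a. \<exists>x. P x a)"
  unfolding depends_on_def by blast

abbreviation seq_index :: "nat \<Rightarrow> (nat \<times> nat) set" where
  "seq_index M \<equiv> {1..} \<times> {1..M}"

abbreviation prefix_index :: "nat \<Rightarrow> nat \<Rightarrow> (nat \<times> nat) set" where
  "prefix_index M n \<equiv> {1..n} \<times> {1..M}"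

lemma prefix_index_subset: "prefix_index M n \<subseteq> seq_index M"
  by auto

definition seq_prob :: "nat \<Rightarrow> ((nat \<times> nat \<Rightarrow> 'a::finite) \<Rightarrow> bool) \<Rightarrow> real" where
  "seq_prob M P = measure (multiseq_measure M) {a \<in> space (multiseq_measure M). P a}"

lemma prob_space_multiseq: "prob_space (multiseq_measure M :: (nat \<times> nat \<Rightarrow> 'a::finite) measure)"
  unfolding multiseq_measure_def by (intro prob_space_PiM prob_space_measure_pmf)

text \<open>The event is the cylinder over a finite set of J-tuples, each of mass q^(-|J|).
  Measurability and probability of everything that follows reduce to this count.\<close>

lemma
  fixes P :: "(nat \<times> nat \<Rightarrow> 'a::finite) \<Rightarrow> bool"
  assumes J: "finite J" "J \<subseteq> seq_index M" and P: "depends_on J P"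
  shows sets_depends_on: "{a \<in> space (multiseq_measure M). P a} \<in> sets (multiseq_measure M)"
    and seq_prob_count: "seq_prob M P = card {x \<in> J \<rightarrow>\<^sub>E UNIV. P x} / real CARD('a) ^ card J"
proof -
  let ?U = "\<lambda>i::nat\<times>nat. measure_pmf (pmf_of_set (UNIV :: 'a set))"
  let ?X = "{x \<in> J \<rightarrow>\<^sub>E UNIV. P x}"
  let ?I = "seq_index M"
  interpret S: product_prob_space ?U ?I
    by unfold_locales
  interpret F: finite_product_prob_space ?U J
    using J by unfold_locales auto
  have finX: "finite ?X"
    using J by (intro finite_subset[OF _ finite_PiE[of J "\<lambda>_. UNIV"]]) auto
  have eq: "{a \<in> space (multiseq_measure M). P a} = prod_emb ?I ?U J ?X"
  proof -
    have "P (restrict a J) = P a" for a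
      by (rule depends_onD[OF P]) simp
    then show ?thesis
      by (auto simp: multiseq_measure_def prod_emb_def space_PiM)
  qed
  have sing: "{x} \<in> sets (PiM J ?U) \<and> emeasure (PiM J ?U) {x} = ennreal (1 / real CARD('a) ^ card J)"
    if "x \<in> ?X" for x
  proof -
    have x: "{x} = PiE J (\<lambda>i. {x i})"
      using that PiE_singleton[of x J] by (auto simp: PiE_def)
    have "{x} \<in> sets (PiM J ?U)"
      unfolding x using J(1) by (intro sets_PiM_I_finite) auto
    moreover have "emeasure (PiM J ?U) {x} = (\<Prod>i\<in>J. emeasure (?U i) {x i})"
      unfolding x using J(1) by (subst S.emeasure_PiM) auto
    moreover have "emeasure (?U i) {x i} = ennreal (1 / real CARD('a))" for i
      by (simp add: emeasure_pmf_single)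
    ultimately show ?thesis
      by (simp add: prod_ennreal power_one_over ennreal_power)
  qed
  have "?X = (\<Union>x\<in>?X. {x})" by auto
  also have "\<dots> \<in> sets (PiM J ?U)"
    using sing finX by (intro sets.finite_UN) auto
  finally have Xs: "?X \<in> sets (PiM J ?U)" .
  show sets: "{a \<in> space (multiseq_measure M). P a} \<in> sets (multiseq_measure M)"
    unfolding eq unfolding multiseq_measure_def using J Xs by (intro measurable_prod_emb)
  have "emeasure (multiseq_measure M) {a \<in> space (multiseq_measure M). P a} = emeasure (PiM J ?U) ?X"
    unfolding eq unfolding multiseq_measure_def using J Xs by (intro S.emeasure_PiM_emb')
  also have "\<dots> = (\<Sum>x\<in>?X. emeasure (PiM J ?U) {x})"
    using sing finX by (intro emeasure_eq_sum_singleton) auto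
  also have "\<dots> = (\<Sum>x\<in>?X. ennreal (1 / real CARD('a) ^ card J))"
    using sing by (intro sum.cong) auto
  also have "\<dots> = ennreal (card ?X / real CARD('a) ^ card J)"
    by (simp add: sum_ennreal del: sum_constant)  simp
  finally show "seq_prob M P = card ?X / real CARD('a) ^ card J"
    by (simp add: seq_prob_def measure_def)
qed

section \<open>Constraints that each determine one symbol\<close>

text \<open>Every configuration on J that satisfies B extends to i in exactly s admissible ways. J
  may contain times after that of i; what B must ignore is i alone.\<close>

lemma seq_prob_pin:
  fixes B E :: "(nat \<times> nat \<Rightarrow> 'a::finite) \<Rightarrow> bool"
  assumes J: "finite J" "J \<subseteq> seq_index M" and i: "i \<in> seq_index M" "i \<notin> J"
    and B: "depends_on J B" and E: "depends_on (insert i J) E"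
    and s: "\<And>a. card {x. E (a(i := x))} = s"
  shows "seq_prob M (\<lambda>a. B a \<and> E a) = seq_prob M B * (s / real CARD('a))"
proof -
  let ?X = "{x \<in> J \<rightarrow>\<^sub>E (UNIV :: 'a set). B x}"
  have Bu: "B (b(i := x)) = B b" for b x
    using i(2) by (intro depends_onD[OF B]) auto
  have finX: "finite ?X"
    using J by (intro finite_subset[OF _ finite_PiE[of J "\<lambda>_. UNIV"]]) auto
  have "bij_betw (\<lambda>(b, x). b(i := x)) (SIGMA b:?X. {x. E (b(i := x))})
          {x \<in> insert i J \<rightarrow>\<^sub>E UNIV. B x \<and> E x}"
  proof (rule bij_betw_imageI)
    show "inj_on (\<lambda>(b, x). b(i := x)) (SIGMA b:?X. {x. E (b(i := x))})"
    proof (rule inj_onI, clarsimp)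
      fix b x c y assume b: "b \<in> J \<rightarrow>\<^sub>E UNIV" "c \<in> J \<rightarrow>\<^sub>E UNIV" and eq: "b(i := x) = c(i := y)"
      have "b k = c k" for k
        using fun_cong[OF eq, of k] b i(2) PiE_arb[OF b(1), of i] PiE_arb[OF b(2), of i]
        by (cases "k = i") auto
      moreover have "x = y" using fun_cong[OF eq, of i] by simp
      ultimately show "b = c \<and> x = y" by auto
    qed
    show "(\<lambda>(b, x). b(i := x)) ` (SIGMA b:?X. {x. E (b(i := x))}) =
        {x \<in> insert i J \<rightarrow>\<^sub>E UNIV. B x \<and> E x}"
      using i(2) Bu by (auto simp: PiE_insert_eq image_iff) 
  qed
  then have "card {x \<in> insert i J \<rightarrow>\<^sub>E UNIV. B x \<and> E x} = card (SIGMA b:?X. {x. E (b(i := x))})"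
    by (simp add: bij_betw_same_card)
  also have "\<dots> = card ?X * s"
    using finX s by simp
  finally have c: "card {x \<in> insert i J \<rightarrow>\<^sub>E UNIV. B x \<and> E x} = card ?X * s" .
  have "depends_on (insert i J) (\<lambda>a. B a \<and> E a)"
    using B E by (auto intro: depends_on_conj depends_on_mono)
  then have "seq_prob M (\<lambda>a. B a \<and> E a) = real (card ?X * s) / real CARD('a) ^ card (insert i J)"
    using J i c by (subst seq_prob_count[of "insert i J"]) auto
  also have "\<dots> = seq_prob M B * (s / real CARD('a))"
    using J i by (subst seq_prob_count[OF J B]) auto
  finally show ?thesis .
qed

text \<open>Constraints are added in order of time, so the new symbol i is always a latest one. By
  \<open>later\<close> no constraint added before reads i, so the conjunction so far ignores it and
  \<open>seq_prob_pin\<close> contributes one factor.\<close>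

lemma seq_prob_chain:
  fixes B :: "(nat \<times> nat \<Rightarrow> 'a::finite) \<Rightarrow> bool" and E :: "nat \<times> nat \<Rightarrow> _"
  assumes "finite S" "S \<subseteq> seq_index M"
    and J: "finite J" "J \<subseteq> seq_index M" "S \<inter> J = {}" "depends_on J B"
    and K: "\<And>i. i \<in> S \<Longrightarrow> finite (K i) \<and> K i \<subseteq> seq_index M \<and> depends_on (K i) (E i)"
    and later: "\<And>i i'. i \<in> S \<Longrightarrow> i' \<in> S \<Longrightarrow> i \<noteq> i' \<Longrightarrow> fst i \<le> fst i' \<Longrightarrow> i' \<notin> K i"
    and s: "\<And>i a. i \<in> S \<Longrightarrow> card {x. E i (a(i := x))} = s i"
  shows "seq_prob M (\<lambda>a. B a \<and> (\<forall>i\<in>S. E i a)) = seq_prob M B * (\<Prod>i\<in>S. s i / real CARD('a))"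
  using assms(1,2) J(3) K later s
proof (induction S rule: finite_ranking_induct[where f = fst])
  case empty
  then show ?case by simp
next
  case (insert i S)
  have IH: "seq_prob M (\<lambda>a. B a \<and> (\<forall>i\<in>S. E i a)) = seq_prob M B * (\<Prod>i\<in>S. s i / real CARD('a))"
  proof (rule insert.IH)
    show "S \<subseteq> seq_index M" "S \<inter> J = {}" using insert.prems(1,2) by blast+
    show "finite (K k) \<and> K k \<subseteq> seq_index M \<and> depends_on (K k) (E k)" if "k \<in> S" for k
      using insert.prems(3) that by blast
    show "k' \<notin> K k" if "k \<in> S" "k' \<in> S" "k \<noteq> k'" "fst k \<le> fst k'" for k k'
      using insert.prems(4) that by blast
    show "card {x. E k (a(k := x))} = s k" if "k \<in> S" for k a
      using insert.prems(5) that by blast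
  qed
  show ?case
  \<comment> \<open>The ranked induction does not promise that the inserted element is new.\<close>
  proof (cases "i \<in> S")
    case True
    then have "insert i S = S" by blast
    then show ?thesis using IH by (simp only:)
  next
    case False
    \<comment> \<open>A common support, without i, for B and the constraints treated so far, large
      enough that constraint i depends on \<open>insert i J'\<close>.\<close>
    define J' where "J' = (J \<union> (\<Union>k\<in>S. K k) \<union> K i) - {i}"
    have iK: "i \<notin> K k" if "k \<in> S" for k
      using insert.prems(4)[of k i] that False insert.hyps(2)[of k] by blast
    have dep: "depends_on J' (\<lambda>a. B a \<and> (\<forall>i\<in>S. E i a))"
    proof (rule depends_on_conj[OF _ depends_on_all])
      have "J \<subseteq> J'" using insert.prems(2) unfolding J'_def by blast
      then show "depends_on J' B" by (rule depends_on_mono[OF J(4)])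
      fix k assume k: "k \<in> S"
      then have "K k \<subseteq> J'" using iK[OF k] unfolding J'_def by blast
      then show "depends_on J' (E k)" using k insert.prems(3)[of k] depends_on_mono by blast
    qed
    have "finite J'"
      unfolding J'_def using J(1) insert.hyps(1) insert.prems(3) by blast
    moreover have "J' \<subseteq> seq_index M"
      unfolding J'_def using J(2) insert.prems(3) by blast
    ultimately have "seq_prob M (\<lambda>a. (B a \<and> (\<forall>i\<in>S. E i a)) \<and> E i a)
        = seq_prob M (\<lambda>a. B a \<and> (\<forall>i\<in>S. E i a)) * (s i / real CARD('a))"
    proof (rule seq_prob_pin[OF _ _ _ _ dep])
      show "i \<in> seq_index M" using insert.prems(1) by blast
      show "i \<notin> J'" by (simp add: J'_def)
      have "K i \<subseteq> insert i J'" unfolding J'_def by blast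
      then show "depends_on (insert i J') (E i)"
        using insert.prems(3)[of i] depends_on_mono by blast
      show "\<And>a. card {x. E i (a(i := x))} = s i" using insert.prems(5) by blast
    qed
    also have "(\<lambda>a. (B a \<and> (\<forall>i\<in>S. E i a)) \<and> E i a) = (\<lambda>a. B a \<and> (\<forall>i\<in>insert i S. E i a))"
      by auto
    finally show ?thesis
      using IH False insert.hyps(1) by (simp add: ac_simps)
  qed
qed

lemma seq_prob_nonneg: "0 \<le> seq_prob M P"
  by (simp add: seq_prob_def)

lemma seq_prob_True: "seq_prob M (\<lambda>a :: nat \<times> nat \<Rightarrow> 'a::finite. True) = 1"
  using prob_space.prob_space[OF prob_space_multiseq[of M, where 'a='a]] by (simp add: seq_prob_def)

lemma seq_prob_False: "seq_prob M (\<lambda>a. False) = 0"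
  by (simp add: seq_prob_def)

lemma seq_prob_mono:
  fixes P Q :: "(nat \<times> nat \<Rightarrow> 'a::finite) \<Rightarrow> bool"
  assumes "finite J" "J \<subseteq> seq_index M" "depends_on J Q" "\<And>a. P a \<Longrightarrow> Q a"
  shows "seq_prob M P \<le> seq_prob M Q"
proof -
  interpret prob_space "multiseq_measure M :: (nat \<times> nat \<Rightarrow> 'a) measure"
    by (rule prob_space_multiseq)
  show ?thesis
    unfolding seq_prob_def using assms(4) sets_depends_on[OF assms(1-3)]
    by (intro finite_measure_mono) auto
qed

lemma seq_prob_Bex_le:
  fixes P :: "'b \<Rightarrow> (nat \<times> nat \<Rightarrow> 'a::finite) \<Rightarrow> bool"
  assumes "finite X" "finite J" "J \<subseteq> seq_index M" "\<And>x. x \<in> X \<Longrightarrow> depends_on J (P x)"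
  shows "seq_prob M (\<lambda>a. \<exists>x\<in>X. P x a) \<le> (\<Sum>x\<in>X. seq_prob M (P x))"
proof -
  interpret prob_space "multiseq_measure M :: (nat \<times> nat \<Rightarrow> 'a) measure"
    by (rule prob_space_multiseq)
  have "{a \<in> space (multiseq_measure M). \<exists>x\<in>X. P x a} = (\<Union>x\<in>X. {a \<in> space (multiseq_measure M). P x a})"
    by auto
  then show ?thesis
    unfolding seq_prob_def using assms sets_depends_on[OF assms(2-4)]
    by (auto intro!: finite_measure_subadditive_finite)
qed

text \<open>Only the term of p0 reads the symbol i, so the condition is an affine equation in x with
  slope \<open>w p0\<close>.\<close>

lemma card_linear_constraint:
  fixes w :: "'p \<Rightarrow> 'a::field" and a :: "'i \<Rightarrow> 'a"
  assumes "finite S" "p0 \<in> S" "\<And>p. p \<in> S \<Longrightarrow> f p = i \<longleftrightarrow> p = p0" "w p0 \<noteq> 0"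
  shows "card {x. (\<Sum>p\<in>S. w p * (a(i := x)) (f p)) = 0} = 1"
proof -
  define R where "R = (\<Sum>p\<in>S - {p0}. w p * a (f p))"
  have "(\<Sum>p\<in>S. w p * (a(i := x)) (f p)) = w p0 * x + R" for x
  proof -
    have "(\<Sum>p\<in>S. w p * (a(i := x)) (f p)) = w p0 * x + (\<Sum>p\<in>S - {p0}. w p * (a(i := x)) (f p))"
      using assms by (subst sum.remove[of S p0]) auto
    also have "(\<Sum>p\<in>S - {p0}. w p * (a(i := x)) (f p)) = R"
      unfolding R_def using assms(3) by (intro sum.cong) auto
    finally show ?thesis .
  qed
  then have "{x. (\<Sum>p\<in>S. w p * (a(i := x)) (f p)) = 0} = {- R / w p0}"
    using assms(4) by (auto simp: field_simps add_eq_0_iff)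
  then show ?thesis by simp
qed

section \<open>Kernels of the block Hankel matrix\<close>

text \<open>For the Hankel matrix with r * M rows and N columns this says that the right kernel is
  nontrivial; \<open>window_relation\<close> says the same of the left kernel. Column combinations
  are register coefficients, row combinations are forecasts from a window of r vectors.\<close>

definition recurrence_relation :: "nat \<Rightarrow> nat \<Rightarrow> nat \<Rightarrow> (nat \<times> nat \<Rightarrow> 'a::field) \<Rightarrow> bool" where
  "recurrence_relation M N r a \<longleftrightarrow> (\<exists>c. (\<exists>i<N. c i \<noteq> 0) \<and>
     (\<forall>j\<in>{1..r}. \<forall>m\<in>{1..M}. (\<Sum>i<N. c i * a (j + i, m)) = 0))"

definition window_relation :: "nat \<Rightarrow> nat \<Rightarrow> nat \<Rightarrow> (nat \<times> nat \<Rightarrow> 'a::field) \<Rightarrow> bool" where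
  "window_relation M r N a \<longleftrightarrow> (\<exists>u. (\<exists>p\<in>{1..r} \<times> {1..M}. u p \<noteq> 0) \<and>
     (\<forall>i<N. (\<Sum>p\<in>{1..r} \<times> {1..M}. u p * a (fst p + i, snd p)) = 0))"

lemma recurrence_relation_depends:
  "depends_on (prefix_index M (r + N)) (recurrence_relation M N r)"
  unfolding recurrence_relation_def
  by (intro depends_on_ex depends_on_conj depends_on_all depends_onI) auto

lemma window_relation_depends:
  "depends_on (prefix_index M (r + N)) (window_relation M r N)"
proof (rule depends_onI)
  fix a b :: "nat \<times> nat \<Rightarrow> 'a"
  assume eq: "\<And>i. i \<in> prefix_index M (r + N) \<Longrightarrow> a i = b i" and "window_relation M r N a"
  have "(\<Sum>p\<in>{1..r} \<times> {1..M}. u p * a (fst p + i, snd p)) = (\<Sum>p\<in>{1..r} \<times> {1..M}. u p * b (fst p + i, snd p))"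
    if "i < N" for u i
    using that by (intro sum.cong refl arg_cong2[of _ _ _ _ "(*)"] eq) auto
  then show "window_relation M r N b"
    using \<open>window_relation M r N a\<close> unfolding window_relation_def by auto
qed

text \<open>With t the highest index where c is nonzero, the condition at (j, m) is an equation for
  \<open>a (j + t, m)\<close> whose other terms lie in the past. Different conditions determine
  different symbols, so their probabilities multiply exactly.\<close>

lemma seq_prob_recurrence:
  fixes c :: "nat \<Rightarrow> 'a::{finite,field}"
  assumes "i < N" "c i \<noteq> 0"
  shows "seq_prob M (\<lambda>a. \<forall>j\<in>{1..r}. \<forall>m\<in>{1..M}. (\<Sum>i<N. c i * a (j + i, m)) = 0)
           = 1 / real CARD('a) ^ (r * M)"
proof -
  define t where "t = Max {i. i < N \<and> c i \<noteq> 0}"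
  have "t \<in> {i. i < N \<and> c i \<noteq> 0}"
    unfolding t_def using assms by (intro Max_in) auto
  then have t: "t < N" "c t \<noteq> 0" by auto
  have above: "c i = 0" if "t < i" "i < N" for i
  proof (rule ccontr)
    assume "c i \<noteq> 0"
    then have "i \<le> t" unfolding t_def using that by (intro Max_ge) auto
    with that show False by simp
  qed
  \<comment> \<open>Conditions are indexed by the symbol that they determine, which shifts the time
    by t.\<close>
  define S where "S = {t+1..t+r} \<times> {1..M}"
  define E where "E p a \<longleftrightarrow> (\<Sum>i<N. c i * a (fst p - t + i, snd p)) = 0"
    for p :: "nat \<times> nat" and a :: "nat \<times> nat \<Rightarrow> 'a"
  have "seq_prob M (\<lambda>a. True \<and> (\<forall>p\<in>S. E p a)) = seq_prob M (\<lambda>a :: _ \<Rightarrow> 'a. True) * (\<Prod>p\<in>S. real 1 / real CARD('a))"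
  proof (rule seq_prob_chain[where J = "{}" and K = "\<lambda>p. {1..fst p} \<times> {snd p}"])
    fix p assume p: "p \<in> S"
    have "depends_on ({1..fst p} \<times> {snd p}) (E p)"
    proof (rule depends_onI)
      fix a b :: "nat \<times> nat \<Rightarrow> 'a"
      assume eq: "\<And>i. i \<in> {1..fst p} \<times> {snd p} \<Longrightarrow> a i = b i" and "E p a"
      have "(\<Sum>i<N. c i * a (fst p - t + i, snd p)) = (\<Sum>i<N. c i * b (fst p - t + i, snd p))"
      proof (rule sum.cong)
        fix i assume i: "i \<in> {..<N}"
        show "c i * a (fst p - t + i, snd p) = c i * b (fst p - t + i, snd p)"
        proof (cases "t < i")
          case True then show ?thesis using above i by simp
        next
          case False
          then have "a (fst p - t + i, snd p) = b (fst p - t + i, snd p)"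
            using p by (intro eq) (auto simp: S_def)
          then show ?thesis by simp
        qed
      qed simp
      with \<open>E p a\<close> show "E p b" by (simp add: E_def)
    qed
    then show "finite ({1..fst p} \<times> {snd p}) \<and> {1..fst p} \<times> {snd p} \<subseteq> seq_index M \<and>
        depends_on ({1..fst p} \<times> {snd p}) (E p)"
      using p by (auto simp: S_def)
    show "card {x. E p (a(p := x))} = 1" for a
      unfolding E_def using p t
      by (intro card_linear_constraint[where ?p0.0 = t]) (auto simp: S_def)
  qed (auto simp: S_def depends_on_def)
  also have "(\<lambda>a. True \<and> (\<forall>p\<in>S. E p a)) = (\<lambda>a. \<forall>j\<in>{1..r}. \<forall>m\<in>{1..M}. (\<Sum>i<N. c i * a (j + i, m)) = 0)"
  proof -
    have S: "S = (\<lambda>(j, m). (j + t, m)) ` ({1..r} \<times> {1..M})"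
    proof -
      have "p \<in> (\<lambda>(j, m). (j + t, m)) ` ({1..r} \<times> {1..M})" if "p \<in> S" for p
        using that by (intro image_eqI[of _ _ "(fst p - t, snd p)"]) (auto simp: S_def)
      then show ?thesis unfolding S_def by auto
    qed
    show ?thesis unfolding S E_def by (intro ext) auto
  qed
  finally show ?thesis by (simp add: seq_prob_True S_def power_one_over)
qed

lemma seq_prob_recurrence_relation:
  "seq_prob M (recurrence_relation M N r :: (nat \<times> nat \<Rightarrow> 'a::{finite,field}) \<Rightarrow> bool)
     \<le> real CARD('a) ^ N / real CARD('a) ^ (r * M)"
proof -
  \<comment> \<open>Extensional functions make the set of coefficient vectors finite, for the union
    bound.\<close>
  let ?X = "{c \<in> {..<N} \<rightarrow>\<^sub>E (UNIV :: 'a set). \<exists>i<N. c i \<noteq> 0}"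
  define P where "P c a \<longleftrightarrow> (\<forall>j\<in>{1..r}. \<forall>m\<in>{1..M}. (\<Sum>i<N. c i * a (j + i, m)) = 0)"
    for c and a :: "nat \<times> nat \<Rightarrow> 'a"
  have fin: "finite ?X"
    by (intro finite_subset[OF _ finite_PiE[of "{..<N}" "\<lambda>_. UNIV"]]) auto
  have dep: "depends_on (prefix_index M (r + N)) (P c)" for c
    unfolding P_def by (intro depends_on_all depends_onI) auto
  have eq: "recurrence_relation M N r = (\<lambda>a. \<exists>c\<in>?X. P c a)"
  proof (rule ext, rule iffI)
    fix a :: "nat \<times> nat \<Rightarrow> 'a" assume "recurrence_relation M N r a"
    then obtain c i where c: "i < N" "c i \<noteq> 0" "P c a"
      unfolding recurrence_relation_def P_def by blast
    then have "restrict c {..<N} \<in> ?X" "P (restrict c {..<N}) a"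
      by (auto simp: P_def intro: exI[of _ i])
    then show "\<exists>c\<in>?X. P c a" by blast
  qed (auto simp: recurrence_relation_def P_def)
  have "seq_prob M (\<lambda>a. \<exists>c\<in>?X. P c a) \<le> (\<Sum>c\<in>?X. seq_prob M (P c))"
    by (rule seq_prob_Bex_le[OF fin _ prefix_index_subset dep]) simp
  then have "seq_prob M (recurrence_relation M N r :: (nat \<times> nat \<Rightarrow> 'a) \<Rightarrow> bool) \<le> (\<Sum>c\<in>?X. seq_prob M (P c))"
    by (simp only: eq)
  also have "\<dots> = card ?X * (1 / real CARD('a) ^ (r * M))"
  proof -
    have "seq_prob M (P c) = 1 / real CARD('a) ^ (r * M)" if c: "c \<in> ?X" for c
    proof -
      obtain i where "i < N" "c i \<noteq> 0" using c by blast
      then show ?thesis unfolding P_def by (rule seq_prob_recurrence)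
    qed
    then show ?thesis by simp
  qed
  also have "\<dots> \<le> real CARD('a) ^ N * (1 / real CARD('a) ^ (r * M))"
  proof (rule mult_right_mono)
    have "card ?X \<le> card ({..<N} \<rightarrow>\<^sub>E (UNIV :: 'a set))"
      by (rule card_mono) (auto intro: finite_PiE)
    also have "\<dots> = CARD('a) ^ N" by (simp add: card_PiE)
    finally show "real (card ?X) \<le> real CARD('a) ^ N" using of_nat_mono by fastforce
  qed simp
  finally show ?thesis by simp
qed

text \<open>With t the latest time at which u has a nonzero weight, at component m0 say, condition i
  determines \<open>a (t + i, m0)\<close>. As only one symbol per time is determined, a condition
  may read the other components at its own time.\<close>

lemma seq_prob_window:
  fixes u :: "nat \<times> nat \<Rightarrow> 'a::{finite,field}"
  assumes "p \<in> {1..r} \<times> {1..M}" "u p \<noteq> 0"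
  shows "seq_prob M (\<lambda>a. \<forall>i\<in>{..<N}. (\<Sum>p\<in>{1..r} \<times> {1..M}. u p * a (fst p + i, snd p)) = 0)
           = 1 / real CARD('a) ^ N"
proof -
  let ?R = "{1..r} \<times> {1..M}"
  let ?J = "{j. \<exists>m. (j, m) \<in> ?R \<and> u (j, m) \<noteq> 0}"
  define t where "t = Max ?J"
  have finJ: "finite ?J" by (rule finite_subset[of _ "{1..r}"]) auto
  moreover have "fst p \<in> ?J"
    using assms by (intro CollectI exI[of _ "snd p"]) auto
  ultimately have "t \<in> ?J"
    unfolding t_def by (intro Max_in) blast+
  then obtain m0 where t: "(t, m0) \<in> ?R" "u (t, m0) \<noteq> 0" by blast
  have above: "u q = 0" if "q \<in> ?R" "t < fst q" for q
  proof (rule ccontr)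
    assume "u q \<noteq> 0"
    with that have "fst q \<in> ?J" by (intro CollectI exI[of _ "snd q"]) auto
    then have "fst q \<le> t" unfolding t_def using finJ by (intro Max_ge) auto
    with that show False by simp
  qed
  define S where "S = {t..<t+N} \<times> {m0}"
  define E where "E q a \<longleftrightarrow> (\<Sum>p\<in>?R. u p * a (fst p + (fst q - t), snd p)) = 0"
    for q :: "nat \<times> nat" and a :: "nat \<times> nat \<Rightarrow> 'a"
  have "seq_prob M (\<lambda>a. True \<and> (\<forall>p\<in>S. E p a)) = seq_prob M (\<lambda>a :: _ \<Rightarrow> 'a. True) * (\<Prod>p\<in>S. real 1 / real CARD('a))"
  proof (rule seq_prob_chain[where J = "{}" and K = "\<lambda>p. prefix_index M (fst p)"])
    fix q assume q: "q \<in> S"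
    have "depends_on (prefix_index M (fst q)) (E q)"
    proof (rule depends_onI)
      fix a b :: "nat \<times> nat \<Rightarrow> 'a"
      assume eq: "\<And>i. i \<in> prefix_index M (fst q) \<Longrightarrow> a i = b i" and "E q a"
      have "(\<Sum>p\<in>?R. u p * a (fst p + (fst q - t), snd p)) = (\<Sum>p\<in>?R. u p * b (fst p + (fst q - t), snd p))"
      proof (rule sum.cong)
        fix p assume p: "p \<in> ?R"
        show "u p * a (fst p + (fst q - t), snd p) = u p * b (fst p + (fst q - t), snd p)"
        proof (cases "t < fst p")
          case True then show ?thesis using above p by simp
        next
          case False
          then have "a (fst p + (fst q - t), snd p) = b (fst p + (fst q - t), snd p)"
            using p q by (intro eq) (auto simp: S_def)
          then show ?thesis by simp
        qed
      qed simp
      with \<open>E q a\<close> show "E q b" by (simp add: E_def)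
    qed
    then show "finite (prefix_index M (fst q)) \<and> prefix_index M (fst q) \<subseteq> seq_index M \<and>
        depends_on (prefix_index M (fst q)) (E q)"
      by auto
    show "card {x. E q (a(q := x))} = 1" for a
      unfolding E_def using q t
      by (intro card_linear_constraint[where ?p0.0 = "(t, m0)"]) (auto simp: S_def)
  qed (use t in \<open>auto simp: S_def depends_on_def\<close>)
  also have "(\<lambda>a. True \<and> (\<forall>p\<in>S. E p a)) = (\<lambda>a. \<forall>i\<in>{..<N}. (\<Sum>p\<in>?R. u p * a (fst p + i, snd p)) = 0)"
  proof -
    have "p \<in> (\<lambda>i. (t + i, m0)) ` {..<N}" if "p \<in> S" for p
      using that by (intro image_eqI[of _ _ "fst p - t"]) (auto simp: S_def)
    then have S: "S = (\<lambda>i. (t + i, m0)) ` {..<N}"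
      unfolding S_def by auto
    show ?thesis unfolding S E_def by (intro ext) auto
  qed
  finally show ?thesis by (simp add: seq_prob_True S_def power_one_over)
qed

lemma seq_prob_window_relation:
  "seq_prob M (window_relation M r N :: (nat \<times> nat \<Rightarrow> 'a::{finite,field}) \<Rightarrow> bool)
     \<le> real CARD('a) ^ (r * M) / real CARD('a) ^ N"
proof -
  let ?R = "{1..r} \<times> {1..M}"
  let ?X = "{u \<in> ?R \<rightarrow>\<^sub>E (UNIV :: 'a set). \<exists>p\<in>?R. u p \<noteq> 0}"
  define P where "P u a \<longleftrightarrow> (\<forall>i\<in>{..<N}. (\<Sum>p\<in>?R. u p * a (fst p + i, snd p)) = 0)"
    for u and a :: "nat \<times> nat \<Rightarrow> 'a"
  have fin: "finite ?X"
    by (intro finite_subset[OF _ finite_PiE[of ?R "\<lambda>_. UNIV"]]) auto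
  have dep: "depends_on (prefix_index M (r + N)) (P u)" for u
    unfolding P_def
  proof (intro depends_on_all depends_onI)
    fix i and a b :: "nat \<times> nat \<Rightarrow> 'a"
    assume i: "i \<in> {..<N}" and eq: "\<And>i. i \<in> prefix_index M (r + N) \<Longrightarrow> a i = b i"
      and *: "(\<Sum>p\<in>?R. u p * a (fst p + i, snd p)) = 0"
    have "(\<Sum>p\<in>?R. u p * a (fst p + i, snd p)) = (\<Sum>p\<in>?R. u p * b (fst p + i, snd p))"
      using i by (intro sum.cong refl arg_cong2[of _ _ _ _ "(*)"] eq) auto
    with * show "(\<Sum>p\<in>?R. u p * b (fst p + i, snd p)) = 0" by simp
  qed
  have eq: "window_relation M r N = (\<lambda>a. \<exists>u\<in>?X. P u a)"
  proof (rule ext, rule iffI)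
    fix a :: "nat \<times> nat \<Rightarrow> 'a" assume "window_relation M r N a"
    then obtain u p where u: "p \<in> ?R" "u p \<noteq> 0" "P u a"
      unfolding window_relation_def P_def by auto
    have "restrict u ?R \<in> ?X" using u by auto
    moreover have "P (restrict u ?R) a"
    proof -
      have "(\<Sum>p\<in>?R. restrict u ?R p * a (fst p + i, snd p)) = (\<Sum>p\<in>?R. u p * a (fst p + i, snd p))" for i
        by (intro sum.cong) auto
      with u(3) show ?thesis by (simp add: P_def)
    qed
    ultimately show "\<exists>u\<in>?X. P u a" by blast
  qed (auto simp: window_relation_def P_def)
  have "seq_prob M (\<lambda>a. \<exists>u\<in>?X. P u a) \<le> (\<Sum>u\<in>?X. seq_prob M (P u))"
    by (rule seq_prob_Bex_le[OF fin _ prefix_index_subset dep]) simp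
  then have "seq_prob M (window_relation M r N :: (nat \<times> nat \<Rightarrow> 'a) \<Rightarrow> bool) \<le> (\<Sum>u\<in>?X. seq_prob M (P u))"
    by (simp only: eq)
  also have "\<dots> = card ?X * (1 / real CARD('a) ^ N)"
  proof -
    have "seq_prob M (P u) = 1 / real CARD('a) ^ N" if u: "u \<in> ?X" for u
    proof -
      obtain p where "p \<in> ?R" "u p \<noteq> 0" using u by blast
      then show ?thesis unfolding P_def by (rule seq_prob_window)
    qed
    then show ?thesis by simp
  qed
  also have "\<dots> \<le> real CARD('a) ^ (r * M) * (1 / real CARD('a) ^ N)"
  proof (rule mult_right_mono)
    have "card ?X \<le> card (?R \<rightarrow>\<^sub>E (UNIV :: 'a set))"
      by (rule card_mono) (auto intro: finite_PiE)
    also have "\<dots> = CARD('a) ^ (r * M)" by (simp add: card_PiE)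
    finally show "real (card ?X) \<le> real CARD('a) ^ (r * M)" using of_nat_mono by fastforce
  qed simp
  finally show ?thesis by simp
qed

section \<open>Linear algebra and linear complexity\<close>

text \<open>Fredholm's alternative, by induction on the columns. Arbitrary finite index sets allow
  rows or columns that are pairs (time, component).\<close>

lemma linear_system_alternative:
  fixes A :: "'i \<Rightarrow> 'j \<Rightarrow> 'a::field"
  assumes "finite I" "finite J"
  shows "(\<exists>x. \<forall>i\<in>I. (\<Sum>j\<in>J. A i j * x j) = b i) \<or>
         (\<exists>y. (\<forall>j\<in>J. (\<Sum>i\<in>I. y i * A i j) = 0) \<and> (\<Sum>i\<in>I. y i * b i) \<noteq> 0)"
  using assms(2)
proof (induction J arbitrary: b)
  case empty
  show ?case
  proof (cases "\<forall>i\<in>I. b i = 0")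
    case False
    then obtain k where k: "k \<in> I" "b k \<noteq> 0" by blast
    then have "(\<Sum>i\<in>I. (if i = k then 1 else 0) * b i) \<noteq> 0"
      using assms(1) by (simp add: if_distrib[of "\<lambda>x. x * _"] cong: if_cong)
    then show ?thesis
      by (intro disjI2 exI[of _ "\<lambda>i. if i = k then 1 else 0"] conjI) simp_all
  qed auto
next
  case (insert l J)
  define dot where "dot y c = (\<Sum>i\<in>I. y i * c i)" for y c :: "'i \<Rightarrow> 'a"
  have dot_diff: "dot y (\<lambda>i. c i - k * d i) = dot y c - k * dot y d" for y c d k
    by (simp add: dot_def algebra_simps sum_subtractf sum_distrib_left)
  have dot_diff': "dot (\<lambda>i. y i - k * z i) c = dot y c - k * dot z c" for y z c k
    by (simp add: dot_def algebra_simps sum_subtractf sum_distrib_left)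
  have sol: "\<exists>x. \<forall>i\<in>I. (\<Sum>j\<in>insert l J. A i j * x j) = b i"
    if "\<forall>i\<in>I. (\<Sum>j\<in>J. A i j * x j) = b i - k * A i l" for k x
  proof (intro exI[of _ "x(l := k)"] ballI)
    fix i assume i: "i \<in> I"
    have "(\<Sum>j\<in>J. A i j * (x(l := k)) j) = (\<Sum>j\<in>J. A i j * x j)"
      using insert.hyps by (intro sum.cong) auto
    then show "(\<Sum>j\<in>insert l J. A i j * (x(l := k)) j) = b i"
      using insert.hyps that i by (simp add: algebra_simps)
  qed
  show ?case
  proof (cases "\<exists>x. \<forall>i\<in>I. (\<Sum>j\<in>J. A i j * x j) = b i")
    case True
    then obtain x where "\<forall>i\<in>I. (\<Sum>j\<in>J. A i j * x j) = b i" by blast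
    then show ?thesis using sol[of x 0] by simp
  next
    case False
    then obtain y where y: "\<And>j. j \<in> J \<Longrightarrow> dot y (\<lambda>i. A i j) = 0" "dot y b \<noteq> 0"
      using insert.IH[of b] unfolding dot_def by blast
    let ?l = "\<lambda>i. A i l"
    show ?thesis
    proof (cases "dot y ?l = 0")
      case True
      then show ?thesis
        using y by (intro disjI2 exI[of _ y]) (auto simp: dot_def)
    next
      case nz: False
      \<comment> \<open>Pairing the system with y kills all columns but l, so k is the only possible
        value of \<open>x l\<close>.\<close>
      define k where "k = dot y b / dot y ?l"
      show ?thesis
      proof (cases "\<exists>x. \<forall>i\<in>I. (\<Sum>j\<in>J. A i j * x j) = b i - k * A i l")
        case True
        then show ?thesis using sol by blast
      next
        case False
        then obtain z where z: "\<And>j. j \<in> J \<Longrightarrow> dot z (\<lambda>i. A i j) = 0" "dot z (\<lambda>i. b i - k * A i l) \<noteq> 0"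
          using insert.IH[of "\<lambda>i. b i - k * A i l"] unfolding dot_def by blast
        \<comment> \<open>Subtracting h times y removes column l from z. The value of k makes the
          pairing of v with b equal to that of z with \<open>b - k * A l\<close>, which is
          nonzero.\<close>
        define h where "h = dot z ?l / dot y ?l"
        define v where "v = (\<lambda>i. z i - h * y i)"
        have dot_v: "dot v c = dot z c - h * dot y c" for c
          unfolding v_def by (rule dot_diff')
        have "dot v (\<lambda>i. A i j) = 0" if "j \<in> insert l J" for j
          using that y(1) z(1) nz by (auto simp: dot_v h_def)
        moreover have "dot v b \<noteq> 0"
        proof -
          have "h * dot y b = k * dot z ?l" by (simp add: h_def k_def)
          with z(2) show ?thesis by (simp add: dot_v dot_diff)
        qed
        ultimately show ?thesis
          by (intro disjI2 exI[of _ v]) (auto simp: dot_def)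
      qed
    qed
  qed
qed

section \<open>Shift registers, relations and linear complexity\<close>

lemma lfsr_generates_mono:
  assumes "lfsr_generates M a n L" "L \<le> L'"
  shows "lfsr_generates M a n L'"
proof -
  obtain c where c: "\<And>k m. L < k \<Longrightarrow> k \<le> n \<Longrightarrow> 1 \<le> m \<Longrightarrow> m \<le> M \<Longrightarrow>
        a (k, m) = (\<Sum>i = 1..L. c i * a (k - i, m))"
    using assms(1) unfolding lfsr_generates_def by blast
  have "a (k, m) = (\<Sum>i = 1..L'. (if i \<le> L then c i else 0) * a (k - i, m))"
    if "L' < k" "k \<le> n" "1 \<le> m" "m \<le> M" for k m
  proof -
    have "(\<Sum>i = 1..L'. (if i \<le> L then c i else 0) * a (k - i, m)) = (\<Sum>i = 1..L. c i * a (k - i, m))"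
      using assms(2) by (intro sum.mono_neutral_cong_right) auto
    with c that assms(2) show ?thesis by simp
  qed
  then show ?thesis unfolding lfsr_generates_def by (intro exI[of _ "\<lambda>i. if i \<le> L then c i else 0"]) blast
qed

lemma lfsr_generates_self: "lfsr_generates M a n n"
  unfolding lfsr_generates_def by auto

lemma lfsr_generates_linear_complexity: "lfsr_generates M a n (linear_complexity M a n)"
  unfolding linear_complexity_def by (rule LeastI, rule lfsr_generates_self)

lemma linear_complexity_le_iff: "linear_complexity M a n \<le> L \<longleftrightarrow> lfsr_generates M a n L"
  using lfsr_generates_mono[OF lfsr_generates_linear_complexity]
  by (auto simp: linear_complexity_def intro: Least_le)

lemma linear_complexity_le: "linear_complexity M a n \<le> n"
  by (simp add: linear_complexity_le_iff lfsr_generates_self)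

lemma lfsr_generates_depends: "depends_on (prefix_index M n) (\<lambda>a. lfsr_generates M a n L)"
proof (rule depends_onI)
  fix a b :: "nat \<times> nat \<Rightarrow> 'a"
  assume eq: "\<And>i. i \<in> prefix_index M n \<Longrightarrow> a i = b i" and "lfsr_generates M a n L"
  then obtain c where c: "\<And>k m. L < k \<Longrightarrow> k \<le> n \<Longrightarrow> 1 \<le> m \<Longrightarrow> m \<le> M \<Longrightarrow>
        a (k, m) = (\<Sum>i = 1..L. c i * a (k - i, m))"
    unfolding lfsr_generates_def by blast
  have "b (k, m) = (\<Sum>i = 1..L. c i * b (k - i, m))" if k: "L < k" "k \<le> n" "1 \<le> m" "m \<le> M" for k m
  proof -
    have "(\<Sum>i = 1..L. c i * b (k - i, m)) = (\<Sum>i = 1..L. c i * a (k - i, m))"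
      using k by (intro sum.cong refl arg_cong2[of _ _ _ _ "(*)"] eq[symmetric]) auto
    with c[OF k] eq[of "(k, m)"] k show ?thesis by simp
  qed
  then show "lfsr_generates M b n L" unfolding lfsr_generates_def by blast
qed

lemma linear_complexity_cong:
  assumes "\<And>i. i \<in> prefix_index M n \<Longrightarrow> a i = b i"
  shows "linear_complexity M a n = linear_complexity M b n"
proof -
  have "lfsr_generates M a n = lfsr_generates M b n"
    by (rule ext) (rule depends_onD[OF lfsr_generates_depends assms])
  then show ?thesis by (simp add: linear_complexity_def)
qed

text \<open>The vector is the reversed connection polynomial. Its coefficient 1 at the newest term
  makes it nonzero even when all feedback coefficients vanish.\<close>

lemma lfsr_generates_imp_recurrence_relation:
  assumes "lfsr_generates M a n L"
  shows "recurrence_relation M (Suc L) (n - L) a"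
proof -
  obtain c where c: "\<And>k m. L < k \<Longrightarrow> k \<le> n \<Longrightarrow> 1 \<le> m \<Longrightarrow> m \<le> M \<Longrightarrow>
        a (k, m) = (\<Sum>i = 1..L. c i * a (k - i, m))"
    using assms(1) unfolding lfsr_generates_def by blast
  define d where "d i = (if i = L then 1 else - c (L - i))" for i
  have "(\<Sum>i<Suc L. d i * a (j + i, m)) = 0" if j: "j \<in> {1..n - L}" "m \<in> {1..M}" for j m
  proof -
    have "(\<Sum>i<Suc L. d i * a (j + i, m)) = a (j + L, m) - (\<Sum>i<L. c (L - i) * a (j + i, m))"
      by (simp add: d_def sum_negf)
    also have "(\<Sum>i<L. c (L - i) * a (j + i, m)) = (\<Sum>i = 1..L. c i * a (j + L - i, m))"
      by (rule sum.reindex_bij_witness[of _ "\<lambda>i. L - i" "\<lambda>i. L - i"]) auto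
    also have "\<dots> = a (j + L, m)"
      using j by (intro c[symmetric]) auto
    finally show ?thesis by simp
  qed
  moreover have "d L \<noteq> 0" by (simp add: d_def)
  ultimately show ?thesis unfolding recurrence_relation_def by blast
qed

text \<open>The register equations form a system with L unknowns and one equation per symbol after
  time L. If it is unsolvable, some weighting of the equations kills all columns; it is nonzero
  because it does not kill the right-hand side.\<close>

lemma not_lfsr_generates_imp_window_relation:
  assumes "\<not> lfsr_generates M a n L"
  shows "window_relation M (n - L) L a"
proof -
  let ?R = "{1..n - L} \<times> {1..M}"
  let ?A = "\<lambda>p i. a (L + fst p - i, snd p)" and ?b = "\<lambda>p. a (L + fst p, snd p)"
  have "\<nexists>x. \<forall>p\<in>?R. (\<Sum>i\<in>{1..L}. ?A p i * x i) = ?b p"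
  proof
    assume "\<exists>x. \<forall>p\<in>?R. (\<Sum>i\<in>{1..L}. ?A p i * x i) = ?b p"
    then obtain x where x: "\<And>p. p \<in> ?R \<Longrightarrow> (\<Sum>i\<in>{1..L}. ?A p i * x i) = ?b p" by blast
    have "a (k, m) = (\<Sum>i = 1..L. x i * a (k - i, m))" if "L < k" "k \<le> n" "1 \<le> m" "m \<le> M" for k m
    proof -
      have "(k - L, m) \<in> ?R" using that by auto
      from x[OF this] that show ?thesis by (simp add: mult.commute)
    qed
    with assms show False unfolding lfsr_generates_def by blast
  qed
  moreover have "finite ?R" by simp
  ultimately have "\<exists>y. (\<forall>i\<in>{1..L}. (\<Sum>p\<in>?R. y p * ?A p i) = 0) \<and> (\<Sum>p\<in>?R. y p * ?b p) \<noteq> 0"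
    using linear_system_alternative[of ?R "{1..L}" ?A ?b] by blast
  then obtain y where y: "\<And>i. i \<in> {1..L} \<Longrightarrow> (\<Sum>p\<in>?R. y p * ?A p i) = 0" "(\<Sum>p\<in>?R. y p * ?b p) \<noteq> 0"
    by blast
  have "\<exists>p\<in>?R. y p \<noteq> 0"
  proof (rule ccontr)
    assume "\<not> ?thesis"
    then have "(\<Sum>p\<in>?R. y p * ?b p) = 0" by (intro sum.neutral) auto
    with y(2) show False by simp
  qed
  moreover have "(\<Sum>p\<in>?R. y p * a (fst p + i, snd p)) = 0" if "i < L" for i
  proof -
    have "(\<Sum>p\<in>?R. y p * a (fst p + i, snd p)) = (\<Sum>p\<in>?R. y p * ?A p (L - i))"
      using that by (intro sum.cong) (auto simp: add.commute)
    also have "\<dots> = 0" using that by (intro y(1)) auto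
    finally show ?thesis .
  qed
  ultimately show ?thesis unfolding window_relation_def by blast
qed

text \<open>The double sum over register coefficients c and weights x is evaluated in both orders:
  through the past successes of x it is the true symbol, through the register it is the forecast.
  For M = 1 this is Massey's bound: a register of length r that first fails at time k forces
  complexity at least k - r from then on.\<close>

lemma not_lfsr_generates_if_prediction_fails:
  assumes "1 \<le> M"
    and pred: "\<And>i. i < N \<Longrightarrow> a (Suc r + i, 1) = (\<Sum>p\<in>{1..r} \<times> {1..M}. x p * a (fst p + i, snd p))"
    and fail: "a (Suc r + N, 1) \<noteq> (\<Sum>p\<in>{1..r} \<times> {1..M}. x p * a (fst p + N, snd p))"
  shows "\<not> lfsr_generates M a (Suc r + N) N"
proof
  let ?R = "{1..r} \<times> {1..M}"
  assume "lfsr_generates M a (Suc r + N) N"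
  then obtain c where c: "\<And>k m. N < k \<Longrightarrow> k \<le> Suc r + N \<Longrightarrow> 1 \<le> m \<Longrightarrow> m \<le> M \<Longrightarrow>
        a (k, m) = (\<Sum>i = 1..N. c i * a (k - i, m))"
    unfolding lfsr_generates_def by blast
  have "a (Suc r + N, 1) = (\<Sum>i = 1..N. c i * a (Suc r + (N - i), 1))"
    using c[of "Suc r + N" 1] assms(1) by (auto simp: Suc_diff_le intro!: sum.cong)
  also have "\<dots> = (\<Sum>i = 1..N. c i * (\<Sum>p\<in>?R. x p * a (fst p + (N - i), snd p)))"
    by (intro sum.cong refl arg_cong2[of _ _ _ _ "(*)"] pred) auto
  also have "\<dots> = (\<Sum>p\<in>?R. \<Sum>i = 1..N. c i * (x p * a (fst p + (N - i), snd p)))"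
    by (simp only: sum_distrib_left) (rule sum.swap)
  also have "\<dots> = (\<Sum>p\<in>?R. x p * (\<Sum>i = 1..N. c i * a (fst p + N - i, snd p)))"
    by (simp add: sum_distrib_left mult.left_commute)
  \<comment> \<open>The register equation is available for every p in the window since
    \<open>fst p + N\<close> exceeds N.\<close>
  also have "\<dots> = (\<Sum>p\<in>?R. x p * a (fst p + N, snd p))"
    by (intro sum.cong refl arg_cong2[of _ _ _ _ "(*)"] c[symmetric]) auto
  finally show False using fail by simp
qed

text \<open>Independent columns mean that the rows span all vectors of length N, so any target b is
  a combination of rows.\<close>

lemma predictor_exists:
  assumes "\<not> recurrence_relation M N r a"
  shows "\<exists>x. \<forall>i<N. b i = (\<Sum>p\<in>{1..r} \<times> {1..M}. x p * a (fst p + i, snd p))"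
proof -
  let ?R = "{1..r} \<times> {1..M}"
  have "\<nexists>y. (\<forall>p\<in>?R. (\<Sum>i<N. y i * a (fst p + i, snd p)) = 0) \<and> (\<Sum>i<N. y i * b i) \<noteq> 0"
  proof
    assume "\<exists>y. (\<forall>p\<in>?R. (\<Sum>i<N. y i * a (fst p + i, snd p)) = 0) \<and> (\<Sum>i<N. y i * b i) \<noteq> 0"
    then obtain y where y: "\<forall>p\<in>?R. (\<Sum>i<N. y i * a (fst p + i, snd p)) = 0"
      "(\<Sum>i<N. y i * b i) \<noteq> 0" by blast
    have "\<exists>i<N. y i \<noteq> 0"
    proof (rule ccontr)
      assume "\<not> ?thesis"
      then have "(\<Sum>i<N. y i * b i) = 0" by (intro sum.neutral) auto
      with y(2) show False by simp
    qed
    moreover have "\<forall>j\<in>{1..r}. \<forall>m\<in>{1..M}. (\<Sum>i<N. y i * a (j + i, m)) = 0" using y(1) by auto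
    ultimately show False using assms(1) unfolding recurrence_relation_def by blast
  qed
  moreover have "finite ?R" by simp
  ultimately have "\<exists>x. \<forall>i\<in>{..<N}. (\<Sum>p\<in>?R. a (fst p + i, snd p) * x p) = b i"
    using linear_system_alternative[of "{..<N}" ?R "\<lambda>i p. a (fst p + i, snd p)" b] by blast
  then obtain x where "\<forall>i\<in>{..<N}. (\<Sum>p\<in>?R. a (fst p + i, snd p) * x p) = b i" by blast
  then show ?thesis by (intro exI[of _ x]) (simp add: mult.commute)
qed

section \<open>Tail bounds and Borel--Cantelli lemmas\<close>

lemma card_field_ge_2: "CARD('a::{finite,field}) \<ge> 2"
proof -
  have "card {0, 1 :: 'a} \<le> CARD('a)" by (intro card_mono) auto
  then show ?thesis by simp
qed

definition lc_excess :: "nat \<Rightarrow> (nat \<times> nat \<Rightarrow> 'a::field) \<Rightarrow> nat \<Rightarrow> int" where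
  "lc_excess M a n = int ((M + 1) * linear_complexity M a n) - int (n * M)"

lemma lc_excess_depends: "depends_on (prefix_index M n) (\<lambda>a. P (lc_excess M a n))"
proof (rule depends_onI)
  fix a b :: "nat \<times> nat \<Rightarrow> 'a"
  assume "\<And>i. i \<in> prefix_index M n \<Longrightarrow> a i = b i" and *: "P (lc_excess M a n)"
  then have "linear_complexity M a n = linear_complexity M b n" by (intro linear_complexity_cong)
  with * show "P (lc_excess M b n)" by (simp add: lc_excess_def)
qed

lemma seq_prob_excess_gt:
  fixes T :: real
  assumes "0 \<le> T"
  shows "seq_prob M (\<lambda>a :: nat \<times> nat \<Rightarrow> 'a::{finite,field}. T < lc_excess M a n)
     \<le> real CARD('a) powr (real M + 1 - T)"
proof -
  let ?q = "real CARD('a)"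
  \<comment> \<open>The largest L with (M + 1) L <= n M + T: excess above T forces complexity above
    L, while rounding loses at most M + 1 in the exponent (n - L) M - L.\<close>
  define L where "L = nat \<lfloor>(real (n * M) + T) / (real M + 1)\<rfloor>"
  have q: "?q > 1" using card_field_ge_2[where 'a='a] by simp
  have "real L \<le> (real (n * M) + T) / (real M + 1)" "(real (n * M) + T) / (real M + 1) < real L + 1"
    unfolding L_def using assms by (simp_all add: of_nat_nat)
  then have L: "(real M + 1) * real L \<le> real (n * M) + T" "real (n * M) + T < (real M + 1) * (real L + 1)"
    by (simp_all add: field_simps)
  have less: "L < linear_complexity M a n" if "T < lc_excess M a n" for a :: "nat \<times> nat \<Rightarrow> 'a"
  proof -
    have "real (n * M) + T < (real M + 1) * real (linear_complexity M a n)"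
      using that by (simp add: lc_excess_def algebra_simps)
    with L(1) have "(real M + 1) * real L < (real M + 1) * real (linear_complexity M a n)" by linarith
    then show ?thesis by (simp add: mult_less_cancel_left_pos)
  qed
  show ?thesis
  proof (cases "L < n")
    case True
    have "seq_prob M (\<lambda>a :: nat \<times> nat \<Rightarrow> 'a. T < lc_excess M a n)
        \<le> seq_prob M (window_relation M (n - L) L :: (nat \<times> nat \<Rightarrow> 'a) \<Rightarrow> bool)"
    proof (rule seq_prob_mono[OF _ prefix_index_subset window_relation_depends])
      fix a :: "nat \<times> nat \<Rightarrow> 'a" assume "T < lc_excess M a n"
      then have "\<not> lfsr_generates M a n L" using less linear_complexity_le_iff leD by blast
      then show "window_relation M (n - L) L a" by (rule not_lfsr_generates_imp_window_relation)
    qed simp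
    also have "\<dots> \<le> ?q ^ ((n - L) * M) / ?q ^ L" by (rule seq_prob_window_relation)
    also have "\<dots> = ?q powr (real ((n - L) * M) - real L)"
      using q by (simp add: powr_diff powr_realpow del: of_nat_mult)
    also have "\<dots> \<le> ?q powr (real M + 1 - T)"
      using q L(2) True by (intro powr_mono) (simp_all add: of_nat_diff algebra_simps)
    finally show ?thesis .
  next
    case False
    have "\<not> T < lc_excess M a n" for a :: "nat \<times> nat \<Rightarrow> 'a"
      using less[of a] linear_complexity_le[of M a n] False by linarith
    then show ?thesis by (simp add: seq_prob_False)
  qed
qed

lemma seq_prob_excess_less:
  fixes T :: real
  assumes "0 \<le> T"
  shows "seq_prob M (\<lambda>a :: nat \<times> nat \<Rightarrow> 'a::{finite,field}. lc_excess M a n < - T)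
     \<le> real CARD('a) powr (1 - T)"
proof (cases "T \<le> real (n * M)")
  case True
  let ?q = "real CARD('a)"
  \<comment> \<open>The L + 1 coefficients compete with (n - L) M conditions; the additional
    coefficient accounts for the 1 in the exponent \<open>1 - T\<close>.\<close>
  define L where "L = nat \<lfloor>(real (n * M) - T) / (real M + 1)\<rfloor>"
  have q: "?q > 1" using card_field_ge_2[where 'a='a] by simp
  have "real L \<le> (real (n * M) - T) / (real M + 1)" "(real (n * M) - T) / (real M + 1) < real L + 1"
    unfolding L_def using True by (simp_all add: of_nat_nat)
  then have L: "(real M + 1) * real L \<le> real (n * M) - T" "real (n * M) - T < (real M + 1) * (real L + 1)"
    by (simp_all add: field_simps)
  have "(real M + 1) * real L \<le> (real M + 1) * real n"
    using L(1) assms by (simp add: algebra_simps)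
  then have Ln: "L \<le> n" by (simp add: mult_le_cancel_left_pos)
  have le: "linear_complexity M a n \<le> L" if "lc_excess M a n < - T" for a :: "nat \<times> nat \<Rightarrow> 'a"
  proof -
    have "(real M + 1) * real (linear_complexity M a n) < real (n * M) - T"
      using that by (simp add: lc_excess_def algebra_simps)
    with L(2) have "(real M + 1) * real (linear_complexity M a n) < (real M + 1) * (real L + 1)" by linarith
    then show ?thesis by (simp add: mult_less_cancel_left_pos)
  qed
  have "seq_prob M (\<lambda>a :: nat \<times> nat \<Rightarrow> 'a. lc_excess M a n < - T)
      \<le> seq_prob M (recurrence_relation M (Suc L) (n - L) :: (nat \<times> nat \<Rightarrow> 'a) \<Rightarrow> bool)"
  proof (rule seq_prob_mono[OF _ prefix_index_subset recurrence_relation_depends])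
    fix a :: "nat \<times> nat \<Rightarrow> 'a" assume "lc_excess M a n < - T"
    then have "lfsr_generates M a n L" using le linear_complexity_le_iff by blast
    then show "recurrence_relation M (Suc L) (n - L) a" by (rule lfsr_generates_imp_recurrence_relation)
  qed simp
  also have "\<dots> \<le> ?q ^ Suc L / ?q ^ ((n - L) * M)" by (rule seq_prob_recurrence_relation)
  also have "\<dots> = ?q powr (real (Suc L) - real ((n - L) * M))"
    using q by (simp only: powr_diff powr_realpow)
  also have "\<dots> \<le> ?q powr (1 - T)"
    using q L(1) Ln by (intro powr_mono) (simp_all add: of_nat_diff algebra_simps)
  finally show ?thesis .
next
  case False
  have "\<not> lc_excess M a n < - T" for a :: "nat \<times> nat \<Rightarrow> 'a"
  proof -
    have "- int (n * M) \<le> lc_excess M a n" by (simp add: lc_excess_def)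
    then have "- real (n * M) \<le> lc_excess M a n" by linarith
    with False show ?thesis by linarith
  qed
  then show ?thesis by (simp add: seq_prob_False)
qed

section \<open>Almost sure bounds and recurrence of block events\<close>

lemma AE_eventually_not:
  fixes P :: "nat \<Rightarrow> (nat \<times> nat \<Rightarrow> 'a::finite) \<Rightarrow> bool"
  assumes "\<And>n. depends_on (prefix_index M (N n)) (P n)" "summable (\<lambda>n. seq_prob M (P n))"
  shows "AE a in multiseq_measure M. \<forall>\<^sub>F n in sequentially. \<not> P n a"
proof -
  interpret prob_space "multiseq_measure M :: (nat \<times> nat \<Rightarrow> 'a) measure"
    by (rule prob_space_multiseq)
  have "AE a in multiseq_measure M. \<forall>\<^sub>F n in sequentially.
      a \<in> space (multiseq_measure M) - {a \<in> space (multiseq_measure M). P n a}"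
  proof (rule borel_cantelli_AE1)
    show "{a \<in> space (multiseq_measure M). P n a} \<in> events" for n
      by (rule sets_depends_on[OF _ prefix_index_subset assms(1)]) simp
    show "emeasure (multiseq_measure M) {a \<in> space (multiseq_measure M). P n a} < \<infinity>" for n
      by (simp add: less_top[symmetric])
    show "summable (\<lambda>n. prob {a \<in> space (multiseq_measure M). P n a})"
      using assms(2) by (simp add: seq_prob_def)
  qed
  then show ?thesis by eventually_elim (auto elim!: eventually_mono)
qed

text \<open>The terms are q^c n^(-1-d), the shape of both tail bounds at height T = (1 + d)
  log_q(n).\<close>

lemma summable_card_powr_log:
  assumes "1 < q" "0 < d"
  shows "summable (\<lambda>n. q powr (c - (1 + d) * log q (real n)))"
proof (rule summable_comparison_test_ev)
  have "summable (\<lambda>n. real n powr (- 1 - d))"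
    using assms by (simp add: summable_real_powr_iff)
  then show "summable (\<lambda>n. q powr c * real n powr (- 1 - d))"
    by (rule summable_mult)
  show "\<forall>\<^sub>F n in sequentially. norm (q powr (c - (1 + d) * log q (real n))) \<le> q powr c * real n powr (- 1 - d)"
    using eventually_gt_at_top[of 0]
  proof eventually_elim
    case (elim n)
    have "c - (1 + d) * log q (real n) = c + log q (real n) * (- (1 + d))" by (simp add: algebra_simps)
    then have "q powr (c - (1 + d) * log q (real n)) = q powr c * (q powr log q (real n)) powr (- (1 + d))"
      by (simp only: powr_add powr_powr)
    also have "q powr log q (real n) = real n" using assms elim by (simp add: powr_log_cancel)
    finally show ?case by (simp add: algebra_simps)
  qed
qed

lemma AE_excess_le:
  assumes "0 < d"
  shows "AE a in multiseq_measure M :: (nat \<times> nat \<Rightarrow> 'a::{finite,field}) measure. \<forall>\<^sub>F n in sequentially.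
           lc_excess M a n \<le> (1 + d) * log CARD('a) (real n)"
proof -
  let ?q = "real CARD('a)"
  have q: "?q > 1" using card_field_ge_2[where 'a='a] by simp
  let ?P = "\<lambda>n (a :: nat \<times> nat \<Rightarrow> 'a). (1 + d) * log ?q (real n) < lc_excess M a n"
  have "summable (\<lambda>n. seq_prob M (?P n))"
  proof (rule summable_comparison_test_ev[OF _ summable_card_powr_log[OF q assms]])
    show "\<forall>\<^sub>F n in sequentially. norm (seq_prob M (?P n)) \<le> ?q powr (real M + 1 - (1 + d) * log ?q (real n))"
      using eventually_gt_at_top[of 0]
    proof eventually_elim
      case (elim n)
      then have "0 \<le> (1 + d) * log ?q (real n)" using q assms by simp
      from seq_prob_excess_gt[OF this, of M n, where 'a='a]
      show ?case by (simp add: seq_prob_nonneg)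
    qed
  qed
  then have "AE a in multiseq_measure M. \<forall>\<^sub>F n in sequentially. \<not> ?P n a"
    by (rule AE_eventually_not[rotated]) (rule lc_excess_depends)
  then show ?thesis by (simp add: not_less)
qed

lemma AE_excess_ge:
  assumes "0 < d"
  shows "AE a in multiseq_measure M :: (nat \<times> nat \<Rightarrow> 'a::{finite,field}) measure. \<forall>\<^sub>F n in sequentially.
           - ((1 + d) * log CARD('a) (real n)) \<le> lc_excess M a n"
proof -
  let ?q = "real CARD('a)"
  have q: "?q > 1" using card_field_ge_2[where 'a='a] by simp
  let ?P = "\<lambda>n (a :: nat \<times> nat \<Rightarrow> 'a). lc_excess M a n < - ((1 + d) * log ?q (real n))"
  have "summable (\<lambda>n. seq_prob M (?P n))"
  proof (rule summable_comparison_test_ev[OF _ summable_card_powr_log[OF q assms]])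
    show "\<forall>\<^sub>F n in sequentially. norm (seq_prob M (?P n)) \<le> ?q powr (1 - (1 + d) * log ?q (real n))"
      using eventually_gt_at_top[of 0]
    proof eventually_elim
      case (elim n)
      then have "0 \<le> (1 + d) * log ?q (real n)" using q assms by simp
      from seq_prob_excess_less[OF this, of M n, where 'a='a]
      show ?case by (simp add: seq_prob_nonneg)
    qed
  qed
  then have "AE a in multiseq_measure M. \<forall>\<^sub>F n in sequentially. \<not> ?P n a"
    by (rule AE_eventually_not[rotated]) (rule lc_excess_depends)
  then show ?thesis by (simp add: not_less)
qed

text \<open>By 1 - x <= exp(-x) the divergent sum drives the product to 0. The start k is arbitrary
  because the events have to recur beyond every k.\<close>

lemma prod_compl_tendsto_0:
  fixes p :: "nat \<Rightarrow> real"
  assumes "\<And>j. 0 \<le> p j" "\<And>j. p j \<le> 1" "\<not> summable p"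
  shows "(\<lambda>K. \<Prod>j=k..<k + K. 1 - p j) \<longlonglongrightarrow> 0"
proof (rule tendsto_sandwich[OF _ _ tendsto_const])
  have "\<not> summable (\<lambda>j. p (j + k))" using assms(3) by (simp add: summable_iff_shift)
  then have "\<not> (\<exists>B. \<forall>K. (\<Sum>j<K. p (j + k)) \<le> B)"
    using summableI_nonneg_bounded[of "\<lambda>j. p (j + k)"] assms(1) by blast
  moreover have "mono (\<lambda>K. \<Sum>j<K. p (j + k))"
    using assms(1) by (intro incseq_SucI) simp
  ultimately have "filterlim (\<lambda>K. \<Sum>j<K. p (j + k)) at_top sequentially"
    unfolding filterlim_at_top eventually_sequentially
  proof (intro allI)
    fix Z
    assume unbdd: "\<not> (\<exists>B. \<forall>K. (\<Sum>j<K. p (j + k)) \<le> B)" and mono: "mono (\<lambda>K. \<Sum>j<K. p (j + k))"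
    obtain K where "\<not> (\<Sum>j<K. p (j + k)) \<le> Z" using unbdd by blast
    then have "Z \<le> (\<Sum>j<K'. p (j + k))" if "K \<le> K'" for K'
      using monoD[OF mono that] by linarith
    then show "\<exists>K. \<forall>K'\<ge>K. Z \<le> (\<Sum>j<K'. p (j + k))" by blast
  qed
  then have "((\<lambda>K. exp (- (\<Sum>j<K. p (j + k)))) \<longlongrightarrow> 0) sequentially"
    by (intro filterlim_compose[OF exp_at_bot] filterlim_uminus_at_bot_at_top[THEN filterlim_compose])
  then show "(\<lambda>K. exp (- (\<Sum>j<K. p (j + k)))) \<longlonglongrightarrow> 0" .
  show "\<forall>\<^sub>F K in sequentially. 0 \<le> (\<Prod>j=k..<k + K. 1 - p j)"
    using assms(2) by (intro always_eventually allI prod_nonneg) auto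
  show "\<forall>\<^sub>F K in sequentially. (\<Prod>j=k..<k + K. 1 - p j) \<le> exp (- (\<Sum>j<K. p (j + k)))"
  proof (intro always_eventually allI)
    fix K
    have "(\<Prod>j=k..<k + K. 1 - p j) \<le> (\<Prod>j=k..<k + K. exp (- p j))"
    proof (rule prod_mono)
      fix j show "0 \<le> 1 - p j \<and> 1 - p j \<le> exp (- p j)"
        using assms(2)[of j] exp_ge_add_one_self[of "- p j"] by simp
    qed
    also have "\<dots> = exp (- (\<Sum>j=k..<k + K. p j))"
      by (simp add: exp_sum sum_negf[symmetric])
    also have "(\<Sum>j=k..<k + K. p j) = (\<Sum>j<K. p (j + k))"
      using sum.shift_bounds_nat_ivl[of p 0 k K] by (simp add: lessThan_atLeast0 add.commute)
    finally show "(\<Prod>j=k..<k + K. 1 - p j) \<le> exp (- (\<Sum>j<K. p (j + k)))" .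
  qed
qed

text \<open>The second Borel--Cantelli lemma for the block events \<open>G j\<close>, each of which has the same
  probability \<open>p j\<close> conditionally on every prefix preceding its block. As the exceptional events
  \<open>Bad j\<close> are decided by those prefixes, they only cost a summable amount.\<close>

lemma AE_infinitely_many_blocks:
  fixes G Bad :: "nat \<Rightarrow> (nat \<times> nat \<Rightarrow> 'a::finite) \<Rightarrow> bool" and N :: "nat \<Rightarrow> nat" and p :: "nat \<Rightarrow> real"
  assumes N: "\<And>j. N j \<le> N (Suc j)"
    and G: "\<And>j. depends_on (prefix_index M (N (Suc j))) (G j)"
    and Bad: "\<And>j. depends_on (prefix_index M (N j)) (Bad j)"
    and p: "\<And>j. 0 \<le> p j" "\<And>j. p j \<le> 1" "\<not> summable p"
    and cond: "\<And>j B. depends_on (prefix_index M (N j)) B \<Longrightarrow> seq_prob M (\<lambda>a. B a \<and> G j a) = seq_prob M B * p j"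
    and Bad_summable: "summable (\<lambda>j. p j * seq_prob M (Bad j))"
  shows "AE a in multiseq_measure M. \<exists>\<^sub>\<infinity>j. G j a \<and> \<not> Bad j a"
proof -
  interpret prob_space "multiseq_measure M :: (nat \<times> nat \<Rightarrow> 'a) measure"
    by (rule prob_space_multiseq)
  have N_mono: "N i \<le> N j" if "i \<le> j" for i j
    using that by (rule lift_Suc_mono_le[of N, OF N])
  have G_mono: "depends_on (prefix_index M (N k)) (G j)" if "j < k" for j k
  proof -
    have "N (Suc j) \<le> N k" using that by (intro N_mono) simp
    then have "prefix_index M (N (Suc j)) \<subseteq> prefix_index M (N k)" by auto
    then show ?thesis by (rule depends_on_mono[OF G])
  qed
  have dep: "depends_on (prefix_index M (N (k + K))) (\<lambda>a. \<forall>j\<in>{k..<k + K}. \<not> G j a)" for k K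
    by (intro depends_on_all depends_on_not G_mono) auto
  have fin: "finite (prefix_index M n)" for n by simp
  \<comment> \<open>Absence of G from blocks k to k + K - 1 is decided before block k + K starts, so
    it may serve as B in \<open>cond\<close>.\<close>
  have none: "seq_prob M (\<lambda>a. \<forall>j\<in>{k..<k + K}. \<not> G j a) = (\<Prod>j=k..<k + K. 1 - p j)" for k K
  proof (induction K)
    case 0
    show ?case by (simp add: seq_prob_True)
  next
    case (Suc K)
    let ?B = "\<lambda>a. \<forall>j\<in>{k..<k + K}. \<not> G j a" and ?G = "G (k + K)"
    let ?S = "\<lambda>P. {a \<in> space (multiseq_measure M). P a}"
    have BG: "depends_on (prefix_index M (N (Suc (k + K)))) (\<lambda>a. ?B a \<and> ?G a)"
      by (intro depends_on_conj depends_on_all depends_on_not G_mono) auto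
    have "(\<lambda>a. \<forall>j\<in>{k..<k + Suc K}. \<not> G j a) = (\<lambda>a. ?B a \<and> \<not> ?G a)"
      by (rule ext) (auto simp: less_Suc_eq)
    moreover have "?S (\<lambda>a. ?B a \<and> \<not> ?G a) = ?S ?B - ?S (\<lambda>a. ?B a \<and> ?G a)" by auto
    moreover have "prob (?S ?B - ?S (\<lambda>a. ?B a \<and> ?G a)) = prob (?S ?B) - prob (?S (\<lambda>a. ?B a \<and> ?G a))"
      using sets_depends_on[OF fin prefix_index_subset dep] sets_depends_on[OF fin prefix_index_subset BG]
      by (intro finite_measure_Diff) auto
    ultimately have "seq_prob M (\<lambda>a. \<forall>j\<in>{k..<k + Suc K}. \<not> G j a) = seq_prob M ?B - seq_prob M (\<lambda>a. ?B a \<and> ?G a)"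
      by (simp only: seq_prob_def)
    also have "\<dots> = seq_prob M ?B * (1 - p (k + K))"
      by (simp only: cond[OF dep] right_diff_distrib mult_1_right)
    finally show ?case using Suc.IH by simp
  qed
  have "AE a in multiseq_measure M. \<exists>j\<ge>k. G j a" for k
  proof (rule AE_I)
    let ?S = "\<lambda>K. {a \<in> space (multiseq_measure M). \<forall>j\<in>{k..<k + K}. \<not> G j a}"
    have sets: "?S K \<in> events" for K
      by (rule sets_depends_on[OF fin prefix_index_subset dep])
    have "(\<lambda>K. \<Prod>j=k..<k + K. 1 - p j) \<longlonglongrightarrow> 0"
      by (rule prod_compl_tendsto_0[OF p])
    then have "(\<lambda>K. prob (?S K)) \<longlonglongrightarrow> 0"
      using none[of k] by (simp add: seq_prob_def)
    moreover have "prob (\<Inter>K. ?S K) \<le> prob (?S K)" for K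
      using sets by (intro finite_measure_mono) auto
    ultimately have "prob (\<Inter>K. ?S K) \<le> 0"
      by (intro LIMSEQ_le_const) auto
    then show "emeasure (multiseq_measure M) (\<Inter>K. ?S K) = 0"
      by (simp add: emeasure_eq_measure measure_le_0_iff)
    show "(\<Inter>K. ?S K) \<in> events" using sets by (intro sets.countable_INT) auto
    show "{a \<in> space (multiseq_measure M). \<not> (\<exists>j\<ge>k. G j a)} \<subseteq> (\<Inter>K. ?S K)" by auto
  qed
  then have "AE a in multiseq_measure M. \<forall>k. \<exists>j\<ge>k. G j a"
    by (simp add: AE_all_countable)
  moreover have "AE a in multiseq_measure M. \<forall>\<^sub>F j in sequentially. \<not> (Bad j a \<and> G j a)"
  proof (rule AE_eventually_not)
    show "depends_on (prefix_index M (N (Suc j))) (\<lambda>a. Bad j a \<and> G j a)" for j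
      using N[of j] by (intro depends_on_conj G depends_on_mono[OF Bad]) auto
    show "summable (\<lambda>j. seq_prob M (\<lambda>a. Bad j a \<and> G j a))"
      using Bad_summable by (simp add: cond[OF Bad] mult.commute)
  qed
  ultimately show ?thesis
  proof eventually_elim
    case (elim a)
    then obtain k where k: "\<And>j. k \<le> j \<Longrightarrow> \<not> (Bad j a \<and> G j a)"
      by (auto simp: eventually_sequentially)
    show ?case unfolding INFM_nat_le
    proof
      fix m
      obtain j where "j \<ge> max m k" "G j a" using elim(1) by blast
      with k[of j] show "\<exists>n\<ge>m. G n a \<and> \<not> Bad n a" by auto
    qed
  qed
qed

section \<open>Prediction and blocks of logarithmic length\<close>

text \<open>Here t prescribes which forecasts come true: a hit leaves one value for the symbol and a
  miss q - 1, whatever f says. By \<open>later\<close> a forecast reads no compared symbol of its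
  own or a later time.\<close>

lemma seq_prob_predicted:
  fixes B :: "(nat \<times> nat \<Rightarrow> 'a::{finite,field}) \<Rightarrow> bool" and f :: "nat \<times> nat \<Rightarrow> (nat \<times> nat \<Rightarrow> 'a) \<Rightarrow> 'a"
  assumes S: "finite S" "S \<subseteq> {n<..} \<times> {1..M}" and B: "depends_on (prefix_index M n) B"
    and K: "\<And>i. i \<in> S \<Longrightarrow> finite (K i) \<and> K i \<subseteq> seq_index M"
    and f: "\<And>i a b. i \<in> S \<Longrightarrow> (\<And>k. k \<in> K i \<Longrightarrow> a k = b k) \<Longrightarrow> f i a = f i b"
    and later: "\<And>i i'. i \<in> S \<Longrightarrow> i' \<in> S \<Longrightarrow> fst i \<le> fst i' \<Longrightarrow> i' \<notin> K i"
  shows "seq_prob M (\<lambda>a. B a \<and> (\<forall>i\<in>S. (a i = f i a) = t i))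
    = seq_prob M B * (\<Prod>i\<in>S. real (if t i then 1 else CARD('a) - 1) / real CARD('a))"
proof (rule seq_prob_chain[where K = "\<lambda>i. insert i (K i)" and J = "prefix_index M n"])
  show "S \<subseteq> seq_index M" using S(2) by auto
  fix i assume i: "i \<in> S"
  have "depends_on (insert i (K i)) (\<lambda>a. (a i = f i a) = t i)"
  proof (rule depends_onI)
    fix a b :: "nat \<times> nat \<Rightarrow> 'a"
    assume eq: "\<And>k. k \<in> insert i (K i) \<Longrightarrow> a k = b k" and *: "(a i = f i a) = t i"
    have "f i a = f i b" using i eq by (intro f) auto
    with * eq[of i] show "(b i = f i b) = t i" by simp
  qed
  then show "finite (insert i (K i)) \<and> insert i (K i) \<subseteq> seq_index M \<and>
      depends_on (insert i (K i)) (\<lambda>a. (a i = f i a) = t i)"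
    using K[OF i] i S(2) by auto
  fix a
  have "f i (a(i := x)) = f i a" for x
    using later[OF i i] by (intro f[OF i]) auto
  then have "{x. ((a(i := x)) i = f i (a(i := x))) = t i} = (if t i then {f i a} else UNIV - {f i a})"
    by auto
  then show "card {x. ((a(i := x)) i = f i (a(i := x))) = t i} = (if t i then 1 else CARD('a) - 1)"
    by simp
next
  fix i i' assume "i \<in> S" "i' \<in> S" "i \<noteq> i'" "fst i \<le> fst i'"
  then show "i' \<notin> insert i (K i)" using later by blast
qed (use S B in \<open>auto simp: prefix_index_subset\<close>)

text \<open>Several registers of minimal length may fit the prefix. Fixing one by choice gives each
  symbol a single forecast; quantifying over all of them would not determine one value per
  symbol.\<close>

definition shift_register :: "nat \<Rightarrow> nat \<Rightarrow> (nat \<times> nat \<Rightarrow> 'a::field) \<Rightarrow> nat \<Rightarrow> 'a" where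
  "shift_register M n a = (SOME c. \<forall>k m. linear_complexity M a n < k \<and> k \<le> n \<and> 1 \<le> m \<and> m \<le> M \<longrightarrow>
     a (k, m) = (\<Sum>i = 1..linear_complexity M a n. c i * a (k - i, m)))"

text \<open>Inside the block the register is fed with the symbols that actually occurred, not with
  its own earlier forecasts.\<close>

definition register_prediction :: "nat \<Rightarrow> nat \<Rightarrow> nat \<times> nat \<Rightarrow> (nat \<times> nat \<Rightarrow> 'a::field) \<Rightarrow> 'a" where
  "register_prediction M n p a =
     (\<Sum>i = 1..linear_complexity M a n. shift_register M n a i * a (fst p - i, snd p))"

lemma shift_register_cong:
  assumes "\<And>p. p \<in> prefix_index M n \<Longrightarrow> a p = b p"
  shows "shift_register M n a = shift_register M n b"
proof -
  let ?L = "linear_complexity M a n"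
  have L: "linear_complexity M b n = ?L"
    using assms by (intro linear_complexity_cong) simp
  have "(a (k, m) = (\<Sum>i = 1..?L. c i * a (k - i, m))) = (b (k, m) = (\<Sum>i = 1..?L. c i * b (k - i, m)))"
    if "?L < k" "k \<le> n" "1 \<le> m" "m \<le> M" for c k m
  proof -
    have "(\<Sum>i = 1..?L. c i * a (k - i, m)) = (\<Sum>i = 1..?L. c i * b (k - i, m))"
      using that by (intro sum.cong refl arg_cong2[of _ _ _ _ "(*)"] assms) auto
    moreover have "a (k, m) = b (k, m)" using that by (intro assms) auto
    ultimately show ?thesis by simp
  qed
  then have "(\<forall>k m. ?L < k \<and> k \<le> n \<and> 1 \<le> m \<and> m \<le> M \<longrightarrow> a (k, m) = (\<Sum>i = 1..?L. c i * a (k - i, m)))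
      = (\<forall>k m. ?L < k \<and> k \<le> n \<and> 1 \<le> m \<and> m \<le> M \<longrightarrow> b (k, m) = (\<Sum>i = 1..?L. c i * b (k - i, m)))" for c
    by blast
  then show ?thesis unfolding shift_register_def L by simp
qed

lemma register_prediction_cong:
  assumes "\<And>i. i \<in> prefix_index M n \<union> {1..<fst p} \<times> {snd p} \<Longrightarrow> a i = b i" "n < fst p"
  shows "register_prediction M n p a = register_prediction M n p b"
proof -
  have "shift_register M n a = shift_register M n b" "linear_complexity M a n = linear_complexity M b n"
    using assms(1) by (auto intro!: shift_register_cong linear_complexity_cong)
  moreover have "a (fst p - i, snd p) = b (fst p - i, snd p)" if "i \<in> {1..linear_complexity M a n}" for i
    using assms(2) that linear_complexity_le[of M a n] by (intro assms(1)) auto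
  ultimately show ?thesis unfolding register_prediction_def by simp
qed

lemma linear_complexity_constant_if_predicted:
  assumes "\<And>p. p \<in> {n<..n + s} \<times> {1..M} \<Longrightarrow> a p = register_prediction M n p a"
  shows "linear_complexity M a (n + s) \<le> linear_complexity M a n"
proof -
  let ?L = "linear_complexity M a n"
  have reg: "\<forall>k m. ?L < k \<and> k \<le> n \<and> 1 \<le> m \<and> m \<le> M \<longrightarrow>
     a (k, m) = (\<Sum>i = 1..?L. shift_register M n a i * a (k - i, m))"
    unfolding shift_register_def
    by (rule someI_ex[OF lfsr_generates_linear_complexity[of M a n, unfolded lfsr_generates_def]])
  have "a (k, m) = (\<Sum>i = 1..?L. shift_register M n a i * a (k - i, m))"
    if "?L < k" "k \<le> n + s" "1 \<le> m" "m \<le> M" for k m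
  proof (cases "k \<le> n")
    case True
    then show ?thesis using reg that by blast
  next
    case False
    then show ?thesis using assms[of "(k, m)"] that by (simp add: register_prediction_def)
  qed
  then show ?thesis unfolding linear_complexity_le_iff lfsr_generates_def by blast
qed

text \<open>The weights are to fit component 1 at all times from r + 1 to n. Where no fit exists the
  choice is arbitrary, yet it still depends on the prefix only, which keeps block probabilities
  exact on bad prefixes too.\<close>

definition window_weights :: "nat \<Rightarrow> nat \<Rightarrow> nat \<Rightarrow> (nat \<times> nat \<Rightarrow> 'a::field) \<Rightarrow> nat \<times> nat \<Rightarrow> 'a" where
  "window_weights M r n a = (SOME x. \<forall>i<n - r. a (Suc r + i, 1) = (\<Sum>p\<in>{1..r} \<times> {1..M}. x p * a (fst p + i, snd p)))"

text \<open>The shift \<open>fst p - Suc r\<close> places the window on the r vectors immediately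
  before time \<open>fst p\<close>.\<close>

definition window_prediction :: "nat \<Rightarrow> nat \<Rightarrow> nat \<Rightarrow> nat \<times> nat \<Rightarrow> (nat \<times> nat \<Rightarrow> 'a::field) \<Rightarrow> 'a" where
  "window_prediction M r n p a =
     (\<Sum>s\<in>{1..r} \<times> {1..M}. window_weights M r n a s * a (fst s + (fst p - Suc r), snd s))"

lemma window_weights_cong:
  assumes "\<And>p. p \<in> prefix_index M n \<Longrightarrow> a p = b p" "1 \<le> M"
  shows "window_weights M r n a = window_weights M r n b"
proof -
  have "(a (Suc r + i, 1) = (\<Sum>p\<in>{1..r} \<times> {1..M}. x p * a (fst p + i, snd p)))
      = (b (Suc r + i, 1) = (\<Sum>p\<in>{1..r} \<times> {1..M}. x p * b (fst p + i, snd p)))"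
    if "i < n - r" for x i
  proof -
    have "(\<Sum>p\<in>{1..r} \<times> {1..M}. x p * a (fst p + i, snd p)) = (\<Sum>p\<in>{1..r} \<times> {1..M}. x p * b (fst p + i, snd p))"
      using that by (intro sum.cong refl arg_cong2[of _ _ _ _ "(*)"] assms(1)) auto
    moreover have "a (Suc r + i, 1) = b (Suc r + i, 1)" using that assms(2) by (intro assms(1)) auto
    ultimately show ?thesis by simp
  qed
  then show ?thesis unfolding window_weights_def by simp
qed

lemma window_prediction_cong:
  assumes "\<And>i. i \<in> {1..<fst p} \<times> {1..M} \<Longrightarrow> a i = b i" "n < fst p" "r \<le> n" "1 \<le> M"
  shows "window_prediction M r n p a = window_prediction M r n p b"
proof -
  have "window_weights M r n a = window_weights M r n b"
    using assms by (intro window_weights_cong) auto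
  moreover have "a (fst s + (fst p - Suc r), snd s) = b (fst s + (fst p - Suc r), snd s)"
    if "s \<in> {1..r} \<times> {1..M}" for s
    using assms(2-4) that by (intro assms(1)) auto
  ultimately show ?thesis unfolding window_prediction_def by simp
qed

text \<open>Weights fitted to the prefix have succeeded n - r times there and s times in the block;
  their failure then excludes every register of length n + s - r.\<close>

lemma linear_complexity_gt_if_prediction_fails:
  assumes M: "1 \<le> M" and "r \<le> n" and nrel: "\<not> recurrence_relation M (n - r) r a"
    and pred: "\<And>k. k \<in> {n<..n + s} \<Longrightarrow> a (k, 1) = window_prediction M r n (k, 1) a"
    and fail: "a (Suc (n + s), 1) \<noteq> window_prediction M r n (Suc (n + s), 1) a"
  shows "n + s - r < linear_complexity M a (Suc (n + s))"
proof -
  let ?x = "window_weights M r n a"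
  have old: "\<forall>i<n - r. a (Suc r + i, 1) = (\<Sum>p\<in>{1..r} \<times> {1..M}. ?x p * a (fst p + i, snd p))"
    unfolding window_weights_def by (rule someI_ex[OF predictor_exists[OF nrel]])
  have "\<not> lfsr_generates M a (Suc r + (n + s - r)) (n + s - r)"
  proof (rule not_lfsr_generates_if_prediction_fails[OF M])
    show "a (Suc r + i, 1) = (\<Sum>p\<in>{1..r} \<times> {1..M}. ?x p * a (fst p + i, snd p))" if "i < n + s - r" for i
    proof (cases "i < n - r")
      case False
      then have "a (Suc r + i, 1) = window_prediction M r n (Suc r + i, 1) a"
        using that assms(2) by (intro pred) auto
      then show ?thesis by (simp add: window_prediction_def)
    qed (use old in blast)
    show "a (Suc r + (n + s - r), 1) \<noteq> (\<Sum>p\<in>{1..r} \<times> {1..M}. ?x p * a (fst p + (n + s - r), snd p))"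
      using fail assms(2) by (simp add: window_prediction_def)
  qed
  then have "\<not> linear_complexity M a (Suc (n + s)) \<le> n + s - r"
    using assms(2) by (simp add: linear_complexity_le_iff)
  then show ?thesis by simp
qed

section \<open>Blocks of logarithmic length\<close>

locale log_blocks =
  fixes q :: real and D :: nat
  assumes q: "1 < q" and D: "1 \<le> D"
begin

text \<open>D is the number of symbols compared per step, so a run of \<open>len j\<close> hits has
  probability of order 1/j. The offset 2 keeps the logarithm positive from j = 0 on.\<close>

definition len :: "nat \<Rightarrow> nat" where
  "len j = nat \<lfloor>log q (real j + 2) / real D\<rfloor>"

text \<open>The step added to each run has room for the final miss of the second construction and
  guarantees \<open>start j >= j\<close> in both.\<close>

definition start :: "nat \<Rightarrow> nat" where
  "start j = (\<Sum>i<j. Suc (len i))"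

lemma start_Suc: "start (Suc j) = Suc (start j + len j)"
  by (simp add: start_def)

lemma start_ge: "j \<le> start j"
  by (induction j) (simp_all add: start_Suc)

lemma log_nonneg: "0 \<le> log q (real j + 2)"
  using q by simp

lemma len_bounds: "real (len j) * real D \<le> log q (real j + 2)" "log q (real j + 2) - real D < real (len j) * real D"
proof -
  have "0 \<le> log q (real j + 2) / real D" using log_nonneg by simp
  then have "real (len j) \<le> log q (real j + 2) / real D" "log q (real j + 2) / real D < real (len j) + 1"
    unfolding len_def by (simp_all add: of_nat_nat)
  then show "real (len j) * real D \<le> log q (real j + 2)" "log q (real j + 2) - real D < real (len j) * real D"
    using D by (simp_all add: field_simps)
qed

lemma power_len_ge: "1 / (real j + 2) \<le> (1 / q) ^ (len j * D)"
proof -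
  have "1 / (real j + 2) = q powr (- log q (real j + 2))"
    using q by (simp add: powr_minus divide_inverse powr_log_cancel)
  also have "\<dots> \<le> q powr (- real (len j * D))"
    using q len_bounds(1)[of j] by (intro powr_mono) auto
  also have "\<dots> = (1 / q) ^ (len j * D)"
    using q by (simp add: powr_minus powr_realpow power_inverse divide_inverse del: of_nat_mult)
  finally show ?thesis .
qed

lemma power_len_le: "(1 / q) ^ (len j * D) \<le> q ^ D / (real j + 2)"
proof -
  have "(1 / q) ^ (len j * D) = q powr (- real (len j * D))"
    using q by (simp add: powr_minus powr_realpow power_inverse divide_inverse del: of_nat_mult)
  also have "\<dots> \<le> q powr (real D - log q (real j + 2))"
    using q len_bounds(2)[of j] by (intro powr_mono) auto
  also have "\<dots> = q ^ D / (real j + 2)"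
    using q by (simp add: powr_diff powr_realpow powr_log_cancel)
  finally show ?thesis .
qed

lemma not_summable_blocks:
  assumes "0 < c"
  shows "\<not> summable (\<lambda>j. (1 / q) ^ (len j * D) * c)"
proof
  assume "summable (\<lambda>j. (1 / q) ^ (len j * D) * c)"
  then have "summable (\<lambda>j. (1 / q) ^ (len j * D) * c / c)" by (rule summable_divide)
  then have "summable (\<lambda>j. (1 / q) ^ (len j * D))" using assms by simp
  then have "summable (\<lambda>j. 1 / real (j + 2))"
    by (rule summable_comparison_test'[where N = 0]) (use power_len_ge in \<open>auto simp: add.commute\<close>)
  then have "summable (\<lambda>j. 1 / real j)" by (subst (asm) summable_iff_shift)
  then show False using not_summable_harmonic[where 'a=real] by (simp add: inverse_eq_divide)
qed

text \<open>A block of order 1/j times a bad prefix of order j^(-d) gives j^(-1-d). The factor c is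
  the price of the closing step: 1, or 1 - 1/q for a miss.\<close>

lemma summable_bad_blocks:
  assumes "0 < d" "0 \<le> c" "c \<le> 1" "\<And>j. 0 \<le> b j"
    and "\<forall>\<^sub>F j in sequentially. b j \<le> q powr (C - d * log q (real j + 2))"
  shows "summable (\<lambda>j. (1 / q) ^ (len j * D) * c * b j)"
proof (rule summable_comparison_test_ev)
  have "summable (\<lambda>j. q powr (C + real D - (1 + d) * log q (real (j + 2))))"
    using summable_card_powr_log[OF q assms(1), of "C + real D"]
    by (subst summable_iff_shift[of _ 2])
  then show "summable (\<lambda>j. q powr (C + real D - (1 + d) * log q (real j + 2)))"
    by (simp add: add.commute)
  show "\<forall>\<^sub>F j in sequentially. norm ((1 / q) ^ (len j * D) * c * b j)
      \<le> q powr (C + real D - (1 + d) * log q (real j + 2))"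
    using assms(5)
  proof eventually_elim
    case (elim j)
    have "(1 / q) ^ (len j * D) * c \<le> (q ^ D / (real j + 2)) * 1"
      using assms(2,3) q by (intro mult_mono power_len_le) auto
    moreover have "q ^ D / (real j + 2) = q powr (real D - log q (real j + 2))"
      using q by (simp add: powr_diff powr_realpow powr_log_cancel)
    ultimately have "(1 / q) ^ (len j * D) * c * b j
        \<le> q powr (real D - log q (real j + 2)) * q powr (C - d * log q (real j + 2))"
      using elim assms(2,4) q by (intro mult_mono) auto
    also have "\<dots> = q powr (C + real D - (1 + d) * log q (real j + 2))"
      by (simp add: powr_add[symmetric] algebra_simps)
    finally show ?case using assms(2,4) q by simp
  qed
qed

lemma start_le: "real (start j) \<le> real j * (log q (real j + 2) + 1)"
proof -
  have "real (Suc (len i)) \<le> log q (real j + 2) + 1" if "i < j" for i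
  proof -
    have "real (len i) \<le> real (len i) * real D" using D by (simp add: mult_le_cancel_left1)
    also have "\<dots> \<le> log q (real i + 2)" by (rule len_bounds)
    also have "\<dots> \<le> log q (real j + 2)" using that q by simp
    finally show ?thesis by simp
  qed
  then have "(\<Sum>i<j. real (Suc (len i))) \<le> (\<Sum>i<j. log q (real j + 2) + 1)"
    by (intro sum_mono) auto
  then show ?thesis by (simp add: start_def del: of_nat_Suc)
qed

text \<open>Blocks end at times of order at most j log j, which has the same logarithm as j to first
  order. This converts gains measured by the block index into gains measured by time.\<close>

lemma log_start_le:
  assumes "0 < e"
  shows "\<forall>\<^sub>F j in sequentially. log q (real (start (Suc j))) \<le> (1 + e) * log q (real j + 2)"
proof -
  have "\<forall>\<^sub>F j in sequentially. ln (real (Suc j) * (ln (real (Suc j) + 2) / ln q + 1)) \<le> (1 + e) * ln (real j + 2)"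
    using assms q by real_asymp
  then show ?thesis
  proof eventually_elim
    case (elim j)
    have "ln (real (start (Suc j))) \<le> ln (real (Suc j) * (ln (real (Suc j) + 2) / ln q + 1))"
    proof (rule ln_mono)
      show "0 < real (start (Suc j))" by (simp add: start_Suc)
      show "real (start (Suc j)) \<le> real (Suc j) * (ln (real (Suc j) + 2) / ln q + 1)"
        using start_le[of "Suc j"] by (simp add: log_def)
    qed
    also note elim
    finally show ?case
      using q by (simp add: log_def divide_right_mono)
  qed
qed

end

section \<open>Attainment of the extreme deviations\<close>

lemma INFM_nat_mono:
  fixes g :: "nat \<Rightarrow> nat"
  assumes "\<exists>\<^sub>\<infinity>j. P (g j)" "\<And>j. j \<le> g j"
  shows "\<exists>\<^sub>\<infinity>n. P n"
  unfolding INFM_nat_le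
proof
  fix m
  obtain j where "m \<le> j" "P (g j)" using assms(1) unfolding INFM_nat_le by blast
  with assms(2)[of j] show "\<exists>n\<ge>m. P n" by (intro exI[of _ "g j"]) auto
qed

text \<open>Once the current register happens to predict the next \<open>s\<close> vectors, which has probability
  \<open>q^(-sM)\<close>, the complexity stalls and the excess drops by \<open>sM\<close>.\<close>

lemma AE_excess_frequently_le:
  fixes d :: real
  assumes M: "1 \<le> M" and d: "0 < d" "d < 1"
  shows "AE a in multiseq_measure M :: (nat \<times> nat \<Rightarrow> 'a::{finite,field}) measure. \<exists>\<^sub>\<infinity>n.
           lc_excess M a n \<le> - ((1 - d) * log CARD('a) (real n))"
proof -
  let ?q = "real CARD('a)"
  interpret log_blocks ?q M
    using card_field_ge_2[where 'a='a] M by unfold_locales auto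
  \<comment> \<open>With l = log_q(j + 2) the excess after the run is at most e l - l + M. Absorbing
    M into (d/2) l leaves -(1 - d + e) l precisely for e = d/4, and (1 - d)(1 + e) <= 1 - d + e pays
    for replacing l by the logarithm of the time.\<close>
  define e where "e = d / 4"
  have e: "0 < e" using d by (simp add: e_def)
  define S where "S j = {start j<..start j + len j} \<times> {1..M}" for j
  define G where "G j a \<longleftrightarrow> (\<forall>p\<in>S j. (a p = register_prediction M (start j) p a) = True)"
    for j and a :: "nat \<times> nat \<Rightarrow> 'a"
  define Bad where "Bad j a \<longleftrightarrow> e * log ?q (real j + 2) < lc_excess M a (start j)"
    for j and a :: "nat \<times> nat \<Rightarrow> 'a"
  have "AE a in multiseq_measure M. \<exists>\<^sub>\<infinity>j. G j a \<and> \<not> Bad j a"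
  proof (rule AE_infinitely_many_blocks[where N = start and p = "\<lambda>j. (1 / ?q) ^ (len j * M) * 1"])
    show "start j \<le> start (Suc j)" for j by (simp add: start_Suc)
    show "depends_on (prefix_index M (start (Suc j))) (G j)" for j
    proof (rule depends_onI)
      fix a b :: "nat \<times> nat \<Rightarrow> 'a"
      assume eq: "\<And>i. i \<in> prefix_index M (start (Suc j)) \<Longrightarrow> a i = b i" and "G j a"
      have "register_prediction M (start j) p a = register_prediction M (start j) p b \<and> a p = b p" if "p \<in> S j" for p
        using that by (auto simp: S_def start_Suc intro!: register_prediction_cong eq)
      with \<open>G j a\<close> show "G j b" by (simp add: G_def)
    qed
    show "depends_on (prefix_index M (start j)) (Bad j)" for j
      unfolding Bad_def by (rule lc_excess_depends)
    show "0 \<le> (1 / ?q) ^ (len j * M) * 1" "(1 / ?q) ^ (len j * M) * 1 \<le> 1" for j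
      using q by (auto intro!: power_le_one)
    show "\<not> summable (\<lambda>j. (1 / ?q) ^ (len j * M) * 1)"
      by (rule not_summable_blocks) simp
    show "seq_prob M (\<lambda>a. B a \<and> G j a) = seq_prob M B * ((1 / ?q) ^ (len j * M) * 1)"
      if B: "depends_on (prefix_index M (start j)) B" for j B
    proof -
      have "seq_prob M (\<lambda>a. B a \<and> G j a)
          = seq_prob M B * (\<Prod>i\<in>S j. real (if True then 1 else CARD('a) - 1) / ?q)"
        unfolding G_def
      proof (rule seq_prob_predicted[where K = "\<lambda>p. prefix_index M (start j) \<union> {1..<fst p} \<times> {snd p}", OF _ _ B])
        show "register_prediction M (start j) i a = register_prediction M (start j) i b"
          if "i \<in> S j" "\<And>k. k \<in> prefix_index M (start j) \<union> {1..<fst i} \<times> {snd i} \<Longrightarrow> a k = b k"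
          for i and a b :: "nat \<times> nat \<Rightarrow> 'a"
          using that(1) by (intro register_prediction_cong that(2)) (auto simp: S_def)
      qed (auto simp: S_def)
      then show ?thesis by (simp add: S_def)
    qed
    show "summable (\<lambda>j. (1 / ?q) ^ (len j * M) * 1 * seq_prob M (Bad j))"
    proof (rule summable_bad_blocks[OF e])
      show "\<forall>\<^sub>F j in sequentially. seq_prob M (Bad j) \<le> ?q powr (real M + 1 - e * log ?q (real j + 2))"
        unfolding Bad_def using e log_nonneg by (intro always_eventually allI seq_prob_excess_gt) simp
    qed (simp_all add: seq_prob_nonneg)
  qed
  then show ?thesis
  proof eventually_elim
    case (elim a)
    have "\<forall>\<^sub>F j in sequentially. real M \<le> d / 2 * log ?q (real j + 2)"
      unfolding log_def using q d by real_asymp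
    moreover note log_start_le[OF e] eventually_ge_at_top[of 1]
    ultimately have "\<forall>\<^sub>F j in sequentially. G j a \<and> \<not> Bad j a \<longrightarrow>
        lc_excess M a (start j + len j) \<le> - ((1 - d) * log ?q (real (start j + len j)))"
    proof eventually_elim
      case (elim j)
      let ?l = "log ?q (real j + 2)"
      show ?case
      proof
        assume *: "G j a \<and> \<not> Bad j a"
        have "linear_complexity M a (start j + len j) \<le> linear_complexity M a (start j)"
          using * by (intro linear_complexity_constant_if_predicted) (auto simp: G_def S_def)
        then have "int ((M + 1) * linear_complexity M a (start j + len j)) \<le> int ((M + 1) * linear_complexity M a (start j))"
          by (intro of_nat_mono mult_le_mono) auto
        then have "lc_excess M a (start j + len j) \<le> lc_excess M a (start j) - int (len j * M)"
          by (simp add: lc_excess_def algebra_simps)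
        then have "real_of_int (lc_excess M a (start j + len j)) \<le> e * ?l - real (len j * M)"
          using * unfolding Bad_def by linarith
        also have "\<dots> \<le> e * ?l - ?l + real M"
          using len_bounds(2)[of j] by simp
        also have "\<dots> \<le> - ((1 - d + e) * ?l)"
          using elim(1) by (simp add: e_def algebra_simps)
        also have "(1 - d) * log ?q (real (start j + len j)) \<le> (1 - d) * ((1 + e) * ?l)"
        proof (rule mult_left_mono)
          have "log ?q (real (start j + len j)) \<le> log ?q (real (start (Suc j)))"
            using elim(3) start_ge[of j] q by (simp add: start_Suc)
          with elim(2) show "log ?q (real (start j + len j)) \<le> (1 + e) * ?l" by linarith
        qed (use d in simp)
        moreover have "(1 - d) * ((1 + e) * ?l) \<le> (1 - d + e) * ?l"
        proof -
          have "0 \<le> e * d * ?l" using e d log_nonneg[of j] by simp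
          then show ?thesis by (simp add: algebra_simps)
        qed
        ultimately show "real_of_int (lc_excess M a (start j + len j)) \<le> - ((1 - d) * log ?q (real (start j + len j)))"
          by linarith
      qed
    qed
    then have "\<exists>\<^sub>\<infinity>j. lc_excess M a (start j + len j) \<le> - ((1 - d) * log ?q (real (start j + len j)))"
      using elim unfolding cofinite_eq_sequentially
      by (rule frequently_rev_mp[rotated])
    then show ?case
      by (rule INFM_nat_mono[where g = "\<lambda>j. start j + len j"]) (use start_ge trans_le_add1 in blast)
  qed
qed

text \<open>Dually, a relation with coefficients in a window of \<open>r\<close> vectors costs only one symbol per step
  to maintain, and once it breaks after holding for \<open>N\<close> steps no register of length \<open>N\<close> survives.\<close>

lemma AE_excess_frequently_ge:
  fixes d :: real
  assumes M: "1 \<le> M" and d: "0 < d" "d < 1"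
  shows "AE a in multiseq_measure M :: (nat \<times> nat \<Rightarrow> 'a::{finite,field}) measure. \<exists>\<^sub>\<infinity>n.
           (1 - d) * log CARD('a) (real n) \<le> lc_excess M a n"
proof -
  let ?q = "real CARD('a)"
  interpret log_blocks ?q "Suc 0"
    using card_field_ge_2[where 'a='a] by unfold_locales auto
  define e where "e = d / 4"
  have e: "0 < e" using d by (simp add: e_def)
  \<comment> \<open>The intended surplus of rows over columns in the Hankel matrix of the prefix. It
    makes dependent columns as rare as j^(-e) and takes only about e log_q(j) from the final
    excess.\<close>
  define h where "h j = nat \<lceil>e * log ?q (real j + 2)\<rceil>" for j
  have h: "e * log ?q (real j + 2) \<le> real (h j)" "real (h j) < e * log ?q (real j + 2) + 1" for j
  proof -
    have "0 \<le> e * log ?q (real j + 2)" using e log_nonneg[of j] by simp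
    then show "e * log ?q (real j + 2) \<le> real (h j)" "real (h j) < e * log ?q (real j + 2) + 1"
      unfolding h_def by linarith+
  qed
  \<comment> \<open>The summand M + 1 makes up for rounding down: (M + 1) r >= start + h, so r M
    rows exceed start - r columns by at least h. The minimum is active for small j only and gives r
    <= start for all j.\<close>
  define r where "r j = min (start j) ((start j + M + 1 + h j) div (M + 1))" for j
  have r_le: "r j \<le> start j" for j by (simp add: r_def)
  have r_upper: "(M + 1) * r j \<le> start j + M + 1 + h j" for j
  proof -
    have "(M + 1) * r j \<le> (M + 1) * ((start j + M + 1 + h j) div (M + 1))"
      by (intro mult_le_mono) (simp_all add: r_def)
    also have "\<dots> \<le> start j + M + 1 + h j" by (rule times_div_less_eq_dividend)
    finally show ?thesis .
  qed
  have r_lower: "\<forall>\<^sub>F j in sequentially. start j + h j \<le> (M + 1) * r j"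
  proof -
    have "\<forall>\<^sub>F j in sequentially. e * log ?q (real j + 2) + 3 \<le> real j"
      unfolding log_def using q e by real_asymp
    then show ?thesis
      using eventually_ge_at_top[of 1]
    proof eventually_elim
      case (elim j)
      have "real (h j) + 2 \<le> real j" using elim(1) h(2)[of j] by linarith
      then have hj: "h j + 2 \<le> start j" using start_ge[of j] by linarith
      obtain M' where M': "M = Suc M'" using M by (cases M) auto
      have "M' * 1 \<le> M' * start j" using elim(2) start_ge[of j] by (intro mult_le_mono) auto
      then have "start j + (Suc M' + 1 + h j) \<le> start j + (start j + M' * start j)" using hj by linarith
      then have le: "start j + M + 1 + h j \<le> (M + 1) * start j" by (simp add: M' algebra_simps)
      have "(start j + M + 1 + h j) div (M + 1) \<le> ((M + 1) * start j) div (M + 1)"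
        using le by (rule div_le_mono)
      also have "\<dots> = start j" by (rule nonzero_mult_div_cancel_left) simp
      finally have r: "r j = (start j + M + 1 + h j) div (M + 1)" by (simp add: r_def)
      have "start j + M + 1 + h j < (M + 1) + (M + 1) * r j"
        unfolding r by (rule dividend_less_times_div) simp
      then show ?case by simp
    qed
  qed
  \<comment> \<open>The block includes its closing time, at which G demands a miss instead of a
    hit.\<close>
  define S where "S j = {start j<..start (Suc j)} \<times> {1 :: nat}" for j
  define G where "G j a \<longleftrightarrow>
      (\<forall>p\<in>S j. (a p = window_prediction M (r j) (start j) p a) = (fst p \<le> start j + len j))"
    for j and a :: "nat \<times> nat \<Rightarrow> 'a"
  define Bad where "Bad j = (recurrence_relation M (start j - r j) (r j) :: (nat \<times> nat \<Rightarrow> 'a) \<Rightarrow> bool)" for j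
  have "AE a in multiseq_measure M. \<exists>\<^sub>\<infinity>j. G j a \<and> \<not> Bad j a"
  proof (rule AE_infinitely_many_blocks[where N = start and p = "\<lambda>j. (1 / ?q) ^ (len j * Suc 0) * (1 - 1 / ?q)"])
    show "start j \<le> start (Suc j)" for j by (simp add: start_Suc)
    show "depends_on (prefix_index M (start (Suc j))) (G j)" for j
    proof (rule depends_onI)
      fix a b :: "nat \<times> nat \<Rightarrow> 'a"
      assume eq: "\<And>i. i \<in> prefix_index M (start (Suc j)) \<Longrightarrow> a i = b i" and "G j a"
      have "window_prediction M (r j) (start j) p a = window_prediction M (r j) (start j) p b \<and> a p = b p"
        if "p \<in> S j" for p
        using that M r_le[of j] by (auto simp: S_def intro!: window_prediction_cong eq)
      with \<open>G j a\<close> show "G j b" by (simp add: G_def)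
    qed
    show "depends_on (prefix_index M (start j)) (Bad j)" for j
      using recurrence_relation_depends[where M = M and r = "r j" and N = "start j - r j"] r_le[of j] by (simp add: Bad_def)
    have "0 \<le> 1 - 1 / ?q" "1 - 1 / ?q \<le> 1" using q by auto
    then show "0 \<le> (1 / ?q) ^ (len j * Suc 0) * (1 - 1 / ?q)" "(1 / ?q) ^ (len j * Suc 0) * (1 - 1 / ?q) \<le> 1" for j
      using q by (auto intro!: mult_le_one power_le_one)
    show "\<not> summable (\<lambda>j. (1 / ?q) ^ (len j * Suc 0) * (1 - 1 / ?q))"
      using q by (intro not_summable_blocks) simp
    show "seq_prob M (\<lambda>a. B a \<and> G j a) = seq_prob M B * ((1 / ?q) ^ (len j * Suc 0) * (1 - 1 / ?q))"
      if B: "depends_on (prefix_index M (start j)) B" for j B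
    proof -
      have "seq_prob M (\<lambda>a. B a \<and> G j a)
          = seq_prob M B * (\<Prod>p\<in>S j. real (if fst p \<le> start j + len j then 1 else CARD('a) - 1) / ?q)"
        unfolding G_def
      proof (rule seq_prob_predicted[where K = "\<lambda>p. {1..<fst p} \<times> {1..M}", OF _ _ B])
        show "window_prediction M (r j) (start j) i a = window_prediction M (r j) (start j) i b"
          if "i \<in> S j" "\<And>k. k \<in> {1..<fst i} \<times> {1..M} \<Longrightarrow> a k = b k"
          for i and a b :: "nat \<times> nat \<Rightarrow> 'a"
          using that(1) M r_le[of j] by (intro window_prediction_cong that(2)) (auto simp: S_def)
      qed (use M in \<open>auto simp: S_def\<close>)
      also have "S j = insert (start (Suc j), 1) ({start j<..start j + len j} \<times> {1})"
        by (auto simp: S_def start_Suc)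
      also have "(\<Prod>p\<in>\<dots>. real (if fst p \<le> start j + len j then 1 else CARD('a) - 1) / ?q)
          = ((?q - 1) / ?q) * (\<Prod>p\<in>{start j<..start j + len j} \<times> {1 :: nat}.
              real (if fst p \<le> start j + len j then 1 else CARD('a) - 1) / ?q)"
        using q by (subst prod.insert) (auto simp: start_Suc of_nat_diff)
      also have "(\<Prod>p\<in>{start j<..start j + len j} \<times> {1 :: nat}.
            real (if fst p \<le> start j + len j then 1 else CARD('a) - 1) / ?q)
          = (\<Prod>p\<in>{start j<..start j + len j} \<times> {1 :: nat}. 1 / ?q)"
        by (intro prod.cong) auto
      finally show ?thesis using q by (simp add: diff_divide_distrib)
    qed
    show "summable (\<lambda>j. (1 / ?q) ^ (len j * Suc 0) * (1 - 1 / ?q) * seq_prob M (Bad j))"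
    proof (rule summable_bad_blocks[OF e])
      show "\<forall>\<^sub>F j in sequentially. seq_prob M (Bad j) \<le> ?q powr (0 - e * log ?q (real j + 2))"
        using r_lower
      proof eventually_elim
        case (elim j)
        have "seq_prob M (Bad j) \<le> ?q ^ (start j - r j) / ?q ^ (r j * M)"
          unfolding Bad_def by (rule seq_prob_recurrence_relation)
        also have "\<dots> = ?q powr (real (start j - r j) - real (r j * M))"
          using q by (simp only: powr_diff powr_realpow)
        also have "\<dots> \<le> ?q powr (0 - e * log ?q (real j + 2))"
        proof (rule powr_mono)
          have "real (start j) + real (h j) \<le> (real M + 1) * real (r j)"
            using of_nat_mono[OF elim, where 'a=real] by (simp add: algebra_simps)
          then show "real (start j - r j) - real (r j * M) \<le> 0 - e * log ?q (real j + 2)"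
            using h(1)[of j] r_le[of j] by (simp add: of_nat_diff algebra_simps)
        qed (use q in simp)
        finally show ?case .
      qed
    qed (use q in \<open>simp_all add: seq_prob_nonneg\<close>)
  qed
  then show ?thesis
  proof eventually_elim
    case (elim a)
    have "\<forall>\<^sub>F j in sequentially. real M + 2 \<le> d / 2 * log ?q (real j + 2)"
      unfolding log_def using q d by real_asymp
    moreover note log_start_le[OF e]
    ultimately have "\<forall>\<^sub>F j in sequentially. G j a \<and> \<not> Bad j a \<longrightarrow>
        (1 - d) * log ?q (real (start (Suc j))) \<le> lc_excess M a (start (Suc j))"
    proof eventually_elim
      case (elim j)
      let ?l = "log ?q (real j + 2)"
      show ?case
      proof
        assume *: "G j a \<and> \<not> Bad j a"
        have "start j + len j - r j < linear_complexity M a (Suc (start j + len j))"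
        proof (rule linear_complexity_gt_if_prediction_fails[OF M r_le])
          show "\<not> recurrence_relation M (start j - r j) (r j) a" using * by (simp add: Bad_def)
          show "a (k, 1) = window_prediction M (r j) (start j) (k, 1) a" if "k \<in> {start j<..start j + len j}" for k
            using * that by (auto simp: G_def S_def start_Suc)
          show "a (Suc (start j + len j), 1) \<noteq> window_prediction M (r j) (start j) (Suc (start j + len j), 1) a"
            using * by (auto simp: G_def S_def start_Suc)
        qed
        then have "start (Suc j) \<le> linear_complexity M a (start (Suc j)) + r j"
          using r_le[of j] by (simp add: start_Suc)
        \<comment> \<open>With the upper bound on r this leaves start (Suc j) - start j - (M + 1) -
          h = len j - M - h for the excess.\<close>
        then have "(M + 1) * start (Suc j) \<le> (M + 1) * linear_complexity M a (start (Suc j)) + (M + 1) * r j"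
          unfolding add_mult_distrib2[symmetric] by (rule mult_le_mono2)
        with r_upper[of j] have "start (Suc j) + M * start (Suc j)
            \<le> (M + 1) * linear_complexity M a (start (Suc j)) + (start j + M + 1 + h j)"
          by simp
        then have "real (start (Suc j) + M * start (Suc j))
            \<le> real ((M + 1) * linear_complexity M a (start (Suc j)) + (start j + M + 1 + h j))"
          by (rule of_nat_mono)
        then have "real (len j) - real M - real (h j) \<le> lc_excess M a (start (Suc j))"
          by (simp add: lc_excess_def start_Suc algebra_simps)
        moreover have "(1 - d) * log ?q (real (start (Suc j))) \<le> (1 - d) * ((1 + e) * ?l)"
          using d elim(2) by (intro mult_left_mono) auto
        moreover have "(1 - d) * ((1 + e) * ?l) \<le> (1 - d + e) * ?l"
        proof -
          have "0 \<le> e * d * ?l" using e d log_nonneg[of j] by simp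
          then show ?thesis by (simp add: algebra_simps)
        qed
        moreover have "(1 - d + e) * ?l = ?l - e * ?l - d / 2 * ?l"
          by (simp add: e_def algebra_simps)
        ultimately show "(1 - d) * log ?q (real (start (Suc j))) \<le> lc_excess M a (start (Suc j))"
          using elim(1) h(2)[of j] len_bounds(2)[of j] by simp
      qed
    qed
    then have "\<exists>\<^sub>\<infinity>j. (1 - d) * log ?q (real (start (Suc j))) \<le> lc_excess M a (start (Suc j))"
      using elim unfolding cofinite_eq_sequentially
      by (rule frequently_rev_mp[rotated])
    then show ?case
    proof (rule INFM_nat_mono[where g = "\<lambda>j. start (Suc j)"])
      show "j \<le> start (Suc j)" for j using start_ge[of "Suc j"] by simp
    qed
  qed
qed

section \<open>From the excess to the limits of the deviation\<close>

lemma limsup_ereal_eqI: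
  fixes f :: "nat \<Rightarrow> real"
  assumes "\<And>e. 0 < e \<Longrightarrow> \<forall>\<^sub>F n in sequentially. f n \<le> c + e"
    and "\<And>e. 0 < e \<Longrightarrow> \<exists>\<^sub>F n in sequentially. c - e \<le> f n"
  shows "limsup (\<lambda>n. ereal (f n)) = ereal c"
proof (rule antisym)
  show "limsup (\<lambda>n. ereal (f n)) \<le> ereal c"
  proof (rule ereal_le_epsilon2)
    fix e :: real assume "0 < e"
    with assms(1) show "limsup (\<lambda>n. ereal (f n)) \<le> ereal c + ereal e"
      by (intro Limsup_bounded) simp
  qed
  show "ereal c \<le> limsup (\<lambda>n. ereal (f n))"
  proof (rule ereal_le_epsilon2)
    fix e :: real assume e: "0 < e"
    show "ereal c \<le> limsup (\<lambda>n. ereal (f n)) + ereal e"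
    proof (rule ccontr)
      assume "\<not> ?thesis"
      then have "limsup (\<lambda>n. ereal (f n)) < ereal (c - e)"
        by (cases "limsup (\<lambda>n. ereal (f n))") auto
      then have "\<forall>\<^sub>F n in sequentially. f n < c - e"
        using Limsup_lessD by fastforce
      then have "\<not> (\<exists>\<^sub>F n in sequentially. c - e \<le> f n)"
        by (simp add: frequently_def not_le)
      with assms(2)[OF e] show False by blast
    qed
  qed
qed

lemma lc_deviation_excess:
  "(real M + 1) * real_of_int (lc_deviation M a n) \<le> lc_excess M a n"
  "lc_excess M a n - (real M + 1) \<le> (real M + 1) * real_of_int (lc_deviation M a n)"
proof -
  let ?x = "real (n * M) / real (M + 1)"
  have x: "(real M + 1) * ?x = real (n * M)" by (simp add: add_eq_0_iff field_simps)
  have "?x \<le> real_of_int \<lceil>?x\<rceil>" "real_of_int \<lceil>?x\<rceil> \<le> ?x + 1" by linarith+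
  then have "(real M + 1) * ?x \<le> (real M + 1) * real_of_int \<lceil>?x\<rceil>"
    "(real M + 1) * real_of_int \<lceil>?x\<rceil> \<le> (real M + 1) * (?x + 1)"
    by (simp_all only: mult_le_cancel_left_pos)
  then show "(real M + 1) * real_of_int (lc_deviation M a n) \<le> lc_excess M a n"
    "lc_excess M a n - (real M + 1) \<le> (real M + 1) * real_of_int (lc_deviation M a n)"
    unfolding lc_deviation_def lc_excess_def using x
    by (simp_all add: algebra_simps)
qed

text \<open>The slack M + 1 is granted on both sides so that the pair (-D, -X) qualifies as well as
  (D, X); the negated pair yields the liminf.\<close>

lemma limsup_deviation:
  fixes X D :: "nat \<Rightarrow> real" and q :: real
  assumes q: "1 < q"
    and D: "\<And>n. (real M + 1) * D n \<le> X n + (real M + 1)" "\<And>n. X n - (real M + 1) \<le> (real M + 1) * D n"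
    and up: "\<And>i. \<forall>\<^sub>F n in sequentially. X n \<le> (1 + 1 / (real i + 2)) * log q (real n)"
    and low: "\<And>i. \<exists>\<^sub>\<infinity>n. (1 - 1 / (real i + 2)) * log q (real n) \<le> X n"
  shows "limsup (\<lambda>n. ereal (D n / ln (real n))) = ereal (1 / ((real M + 1) * ln q))"
proof (rule limsup_ereal_eqI)
  define c where "c = 1 / ((real M + 1) * ln q)"
  have c: "0 < c" using q by (simp add: c_def add_pos_nonneg)
  have lg: "(real M + 1) * (c * x) = x / ln q" for x
  proof -
    have "K * (1 / (K * l) * x) = x / l" if "0 < K" for K l :: real
      using that by simp
    then show ?thesis by (simp add: c_def add_nonneg_pos)
  qed
  fix e :: real assume e: "0 < e"
  \<comment> \<open>Half of e pays for the relative error 1/(i + 2), the other half, for large n,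
    for the rounding constant.\<close>
  obtain i :: nat where i: "2 * c / e < real i" using reals_Archimedean2 by blast
  then have "2 * c < e * (real i + 2)" using e by (simp add: field_simps)
  then have ci: "c / (real i + 2) \<le> e / 2" by (simp add: field_simps)
  have ev: "\<forall>\<^sub>F n in sequentially. 1 \<le> e / 2 * ln (real n) \<and> 0 < ln (real n)"
    using e by (intro eventually_conj; real_asymp)
  have M1: "0 < real M + 1" by simp
  have bound: "c / (real i + 2) * ln (real n) \<le> e / 2 * ln (real n)" if "0 < ln (real n)" for n
    using that ci by (intro mult_right_mono) auto
  have "\<forall>\<^sub>F n in sequentially. D n / ln (real n) \<le> c + e"
    using up[of i] ev
  proof eventually_elim
    case (elim n)
    have "(real M + 1) * D n \<le> (real M + 1) * (c * ((1 + 1 / (real i + 2)) * ln (real n))) + (real M + 1)"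
      using elim(1) D(1)[of n] unfolding lg by (simp add: log_def)
    also have "\<dots> = (real M + 1) * (c * ((1 + 1 / (real i + 2)) * ln (real n)) + 1)"
      by (simp add: distrib_left)
    finally have "D n \<le> c * ((1 + 1 / (real i + 2)) * ln (real n)) + 1"
      using M1 by (simp only: mult_le_cancel_left_pos)
    also have "\<dots> = c * ln (real n) + c / (real i + 2) * ln (real n) + 1"
      by (simp add: algebra_simps)
    also have "\<dots> \<le> c * ln (real n) + e / 2 * ln (real n) + e / 2 * ln (real n)"
      using elim(2) bound[of n] by linarith
    also have "\<dots> = (c + e) * ln (real n)"
      by (simp add: field_simps)
    finally show ?case using elim(2) by (simp add: divide_le_eq)
  qed
  then show "\<forall>\<^sub>F n in sequentially. D n / ln (real n) \<le> 1 / ((real M + 1) * ln q) + e"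
    by (simp add: c_def)
  have "\<exists>\<^sub>F n in sequentially. (1 - 1 / (real i + 2)) * log q (real n) \<le> X n"
    using low[of i] by (simp add: cofinite_eq_sequentially)
  moreover have "\<forall>\<^sub>F n in sequentially. (1 - 1 / (real i + 2)) * log q (real n) \<le> X n \<longrightarrow> c - e \<le> D n / ln (real n)"
    using ev
  proof eventually_elim
    case (elim n)
    show ?case
    proof
      assume *: "(1 - 1 / (real i + 2)) * log q (real n) \<le> X n"
      have "(real M + 1) * (c * ((1 - 1 / (real i + 2)) * ln (real n))) - (real M + 1) \<le> (real M + 1) * D n"
        using * D(2)[of n] unfolding lg by (simp add: log_def)
      then have "(real M + 1) * (c * ((1 - 1 / (real i + 2)) * ln (real n)) - 1) \<le> (real M + 1) * D n"
        by (simp add: right_diff_distrib)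
      then have "c * ((1 - 1 / (real i + 2)) * ln (real n)) - 1 \<le> D n"
        using M1 by (simp only: mult_le_cancel_left_pos)
      moreover have "c * ((1 - 1 / (real i + 2)) * ln (real n)) = c * ln (real n) - c / (real i + 2) * ln (real n)"
        by (simp add: algebra_simps)
      ultimately have "c * ln (real n) - e / 2 * ln (real n) - e / 2 * ln (real n) \<le> D n"
        using elim bound[of n] by linarith
      then have "(c - e) * ln (real n) \<le> D n"
        by (simp add: field_simps)
      then show "c - e \<le> D n / ln (real n)" using elim by (simp add: le_divide_eq)
    qed
  qed
  ultimately have "\<exists>\<^sub>F n in sequentially. c - e \<le> D n / ln (real n)"
    by (rule frequently_rev_mp)
  then show "\<exists>\<^sub>F n in sequentially. 1 / ((real M + 1) * ln q) - e \<le> D n / ln (real n)"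
    by (simp add: c_def)
qed

theorem mainTheorem14:
  fixes M :: nat
  assumes "M \<ge> 1"
  shows "AE a in (multiseq_measure M :: (nat \<times> nat \<Rightarrow> 'a::{finite,field}) measure).
           limsup (\<lambda>n. ereal (real_of_int (lc_deviation M a n) / ln (real n)))
             = ereal (1 / ((real M + 1) * ln (real CARD('a)))) \<and>
           liminf (\<lambda>n. ereal (real_of_int (lc_deviation M a n) / ln (real n)))
             = ereal (- 1 / ((real M + 1) * ln (real CARD('a))))"
proof -
  let ?q = "real CARD('a)"
  have q: "1 < ?q" using card_field_ge_2[where 'a='a] by simp
  have d: "0 < 1 / (real i + 2)" "1 / (real i + 2) < 1" for i by simp_all
  \<comment> \<open>A countable family of tolerances, all in (0, 1), allows a single null set for
    all of them.\<close>
  have "AE a in (multiseq_measure M :: (nat \<times> nat \<Rightarrow> 'a) measure). \<forall>i.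
      (\<forall>\<^sub>F n in sequentially. lc_excess M a n \<le> (1 + 1 / (real i + 2)) * log ?q (real n)) \<and>
      (\<forall>\<^sub>F n in sequentially. - ((1 + 1 / (real i + 2)) * log ?q (real n)) \<le> lc_excess M a n) \<and>
      (\<exists>\<^sub>\<infinity>n. lc_excess M a n \<le> - ((1 - 1 / (real i + 2)) * log ?q (real n))) \<and>
      (\<exists>\<^sub>\<infinity>n. (1 - 1 / (real i + 2)) * log ?q (real n) \<le> lc_excess M a n)"
    unfolding AE_all_countable
    by (intro allI AE_conjI AE_excess_le AE_excess_ge AE_excess_frequently_le AE_excess_frequently_ge assms d)
  then show ?thesis
  proof eventually_elim
    case (elim a)
    have lim: "limsup (\<lambda>n. ereal (real_of_int (lc_deviation M a n) / ln (real n)))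
        = ereal (1 / ((real M + 1) * ln ?q))"
    proof (rule limsup_deviation[where X = "\<lambda>n. real_of_int (lc_excess M a n)", OF q])
      show "(real M + 1) * real_of_int (lc_deviation M a n) \<le> lc_excess M a n + (real M + 1)" for n
        using lc_deviation_excess(1)[of M a n] by linarith
    qed (use elim lc_deviation_excess in auto)
    have "limsup (\<lambda>n. ereal (- real_of_int (lc_deviation M a n) / ln (real n)))
        = ereal (1 / ((real M + 1) * ln ?q))"
    proof (rule limsup_deviation[where X = "\<lambda>n. - real_of_int (lc_excess M a n)", OF q])
      show "(real M + 1) * - real_of_int (lc_deviation M a n) \<le> - real_of_int (lc_excess M a n) + (real M + 1)" for n
        using lc_deviation_excess(2)[of M a n] by simp
      show "- real_of_int (lc_excess M a n) - (real M + 1) \<le> (real M + 1) * - real_of_int (lc_deviation M a n)" for n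
        using lc_deviation_excess(1)[of M a n] by simp
      show "\<forall>\<^sub>F n in sequentially. - real_of_int (lc_excess M a n) \<le> (1 + 1 / (real i + 2)) * log ?q (real n)" for i
      proof -
        have "\<forall>\<^sub>F n in sequentially. - ((1 + 1 / (real i + 2)) * log ?q (real n)) \<le> lc_excess M a n"
          using elim by blast
        then show ?thesis by eventually_elim linarith
      qed
      show "\<exists>\<^sub>\<infinity>n. (1 - 1 / (real i + 2)) * log ?q (real n) \<le> - real_of_int (lc_excess M a n)" for i
      proof -
        have "\<exists>\<^sub>\<infinity>n. lc_excess M a n \<le> - ((1 - 1 / (real i + 2)) * log ?q (real n))"
          using elim by blast
        then show ?thesis by (rule frequently_elim1) linarith
      qed
    qed
    moreover have "limsup (\<lambda>n. ereal (- real_of_int (lc_deviation M a n) / ln (real n)))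
        = - liminf (\<lambda>n. ereal (real_of_int (lc_deviation M a n) / ln (real n)))"
      by (simp add: ereal_Limsup_uminus[symmetric])
    ultimately have "ereal (1 / ((real M + 1) * ln ?q))
        = - liminf (\<lambda>n. ereal (real_of_int (lc_deviation M a n) / ln (real n)))"
      by simp
    then have "liminf (\<lambda>n. ereal (real_of_int (lc_deviation M a n) / ln (real n)))
        = - ereal (1 / ((real M + 1) * ln ?q))"
      by (metis ereal_uminus_uminus)
    with lim show ?case by simp
  qed
qed

end
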